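(* Let $q$ be a real number with $q>0$ and $q\neq 1$, and let $\mu=(\mu_{1},\ldots,\mu_{r})$ be a fixed integer partition. For $n\geq|\mu|$, let $T_{\mu}=T_{\sigma_{\mu}}\in\mathscr{H}_{q}(\mathfrak{S}_{n})$ be the basis element associated to the permutation $$\sigma_{\mu}=(1,2,\ldots,\mu_{1})(\mu_{1}+1,\ldots,\mu_{1}+\mu_{2})\cdots(\mu_{1}+\cdots+\mu_{r-1}+1,\ldots,|\mu|),$$ which is of minimal length in its conjugacy class. Let $\lambda=\lambda^{(n)}$ be a random partition of $n$ distributed according to the $q$-Plancherel measure $M_{n,q}$. When $n$ goes to infinity, $\chi^{\lambda}_{q}(T_{\mu})$ converges in probability towards the trace $\tau_{q}(T_{\mu})$. In particular, for all $k\geq 2$, $\chi^{\lambda}_{q}(k)\to 0$ in probability.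
   Context: For $q>0$ real, the Hecke algebra $\mathscr{H}_{q}(\mathfrak{S}_{n})$ of the symmetric group $\mathfrak{S}_{n}$ is the complex unital associative algebra with generators $T_{1},\ldots,T_{n-1}$ and relations $(T_{i}-q)(T_{i}+1)=0$ for all $i$; $T_{i}T_{i+1}T_{i}=T_{i+1}T_{i}T_{i+1}$ for all $i$; and $T_{i}T_{j}=T_{j}T_{i}$ whenever $|i-j|\geq 2$. It has a linear basis $(T_{\sigma})_{\sigma\in\mathfrak{S}_{n}}$, where $T_{\sigma}=T_{i_{1}}T_{i_{2}}\cdots T_{i_{r}}$ for any reduced expression $\sigma=s_{i_{1}}s_{i_{2}}\cdots s_{i_{r}}$ of $\sigma$ in the elementary transpositions $s_{i}=(i,i+1)$. For $q>0$ the algebra is semisimple, and its irreducible representations $V_{\lambda,q}$ are labelled by the integer partitions $\lambda$ of $n$ (the set of these is denoted $\mathfrak{P}_{n}$), $V_{\lambda,q}$ being the deformation of the irreducible representation of $\mathfrak{S}_{n}$ of type $\lambda$, which corresponds to $q=1$. The normalized irreducible character is $\chi^{\lambda}_{q}(x)=\mathrm{tr}(x|_{V_{\lambda,q}})/\dim V_{\lambda,q}$ for $x \in \mathscr{H}_{q}(\mathfrak{S}_{n})$, and $\chi^{\lambda}_{q}(k)=\chi^{\lambda}_{q}(T_{1}T_{2}\cdots T_{k-1})$ for $n\geq k$. For a partition $\mu$, $|\mu|$ denotes the sum of its parts. The canonical trace $\tau_{q}$ of $\mathscr{H}_{q}(\mathfrak{S}_{n})$ is the linear form with $\tau_{q}(T_{\sigma})=1$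 if $\sigma=1$ and $\tau_{q}(T_{\sigma})=0$ otherwise. The $q$-Plancherel measure $M_{n,q}$ is the probability measure on $\mathfrak{P}_{n}$ given by the weights in the (unique) decomposition $$\tau_{q}=\sum_{\lambda\in\mathfrak{P}_{n}}M_{n,q}(\lambda)\,\chi^{\lambda}_{q}.$$ *)

theory Defs
  imports
    "HOL-Probability.Probability_Mass_Function"
    "HOL-Combinatorics.Cycles"
    "HOL-Algebra.QuotRing"
    "Jordan_Normal_Form.VS_Connect"
begin

section \<open>Integer partitions\<close>

definition int_partition :: "nat list \<Rightarrow> bool" where
  "int_partition lam \<longleftrightarrow> sorted_wrt (\<ge>) lam \<and> 0 \<notin> set lam"

definition int_partitions :: "nat \<Rightarrow> nat list set" where
  "int_partitions n = {lam. int_partition lam \<and> sum_list lam = n}"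

definition conjugate_partition :: "nat list \<Rightarrow> nat list" where
  "conjugate_partition lam =
     map (\<lambda>j. length (filter (\<lambda>p. j \<le> p) lam)) [1..<Suc (foldr max lam 0)]"

section \<open>The free algebra\<close>

text \<open>
  Elements of the free complex algebra on an alphabet are finitely supported functions on words;
  the product is the one extending concatenation.  Complex scalars are embedded as multiples of
  the empty word, so a two-sided ideal of this ring is automatically a linear subspace.
\<close>

definition free_algebra :: "'a set \<Rightarrow> ('a list \<Rightarrow> complex) ring" where
  "free_algebra A =
     \<lparr> carrier = {f. finite {w. f w \<noteq> 0} \<and> {w. f w \<noteq> 0} \<subseteq> lists A},
       mult = (\<lambda>f g w. \<Sum>(u, v) | u @ v = w. f u * g v),
       one = (\<lambda>w. if w = [] then 1 else 0),
       zero = (\<lambda>w. 0),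
       add = (\<lambda>f g w. f w + g w) \<rparr>"

definition free_scalar :: "complex \<Rightarrow> 'a list \<Rightarrow> complex" where
  "free_scalar c = (\<lambda>w. if w = [] then c else 0)"

definition free_gen :: "'a \<Rightarrow> 'a list \<Rightarrow> complex" where
  "free_gen i = (\<lambda>w. if w = [i] then 1 else 0)"

lemma finite_splits: "finite {(u, v). u @ v = (w :: 'a list)}"
proof -
  have "{(u, v). u @ v = w} \<subseteq> (\<lambda>k. (take k w, drop k w)) ` {..length w}"
  proof clarify
    fix u v assume "w = u @ v"
    then show "(u, v) \<in> (\<lambda>k. (take k (u @ v), drop k (u @ v))) ` {..length (u @ v)}"
      by (intro image_eqI[where x = "length u"]) auto
  qed
  then show ?thesis by (rule finite_subset) auto
qed

lemma free_algebra_ring: "ring (free_algebra A)"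
proof (rule ringI)
  show "abelian_group (free_algebra A)"
  proof (rule abelian_groupI)
    fix x y assume "x \<in> carrier (free_algebra A)" "y \<in> carrier (free_algebra A)"
    moreover have "{w. x w + y w \<noteq> 0} \<subseteq> {w. x w \<noteq> 0} \<union> {w. y w \<noteq> 0}"
      by auto
    ultimately show "x \<oplus>\<^bsub>free_algebra A\<^esub> y \<in> carrier (free_algebra A)"
      unfolding free_algebra_def
      by simp (meson Un_least finite_UnI finite_subset order_trans)
  next
    fix x assume "x \<in> carrier (free_algebra A)"
    then show "\<exists>y\<in>carrier (free_algebra A). y \<oplus>\<^bsub>free_algebra A\<^esub> x = \<zero>\<^bsub>free_algebra A\<^esub>"
      by (intro bexI[of _ "\<lambda>w. - x w"]) (auto simp: free_algebra_def)
  qed (auto simp: free_algebra_def algebra_simps)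
next
  show "Group.monoid (free_algebra A)"
  proof (rule monoidI)
    fix x y assume xy: "x \<in> carrier (free_algebra A)" "y \<in> carrier (free_algebra A)"
    let ?S = "(\<lambda>(u, v). u @ v) ` ({w. x w \<noteq> 0} \<times> {w. y w \<noteq> 0})"
    have "{w. (\<Sum>(u, v) | u @ v = w. x u * y v) \<noteq> 0} \<subseteq> ?S"
    proof
      fix w assume "w \<in> {w. (\<Sum>(u, v) | u @ v = w. x u * y v) \<noteq> 0}"
      then obtain p where "p \<in> {(u, v). u @ v = w}" "(case p of (u, v) \<Rightarrow> x u * y v) \<noteq> 0"
        by (auto elim: sum.not_neutral_contains_not_neutral)
      then show "w \<in> ?S" by (auto simp: image_iff)
    qed
    then have supp: "{w. (x \<otimes>\<^bsub>free_algebra A\<^esub> y) w \<noteq> 0} \<subseteq> ?S"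
      by (simp add: free_algebra_def)
    have fin: "finite ?S"
      using xy by (auto simp: free_algebra_def)
    have app: "u @ v \<in> lists A" if "x u \<noteq> 0" "y v \<noteq> 0" for u v
      unfolding append_in_lists_conv using xy that by (simp add: free_algebra_def subset_iff)
    have lists: "?S \<subseteq> lists A"
    proof (intro image_subsetI)
      fix p assume "p \<in> {w. x w \<noteq> 0} \<times> {w. y w \<noteq> 0}"
      then have "x (fst p) \<noteq> 0" "y (snd p) \<noteq> 0" by auto
      from app[OF this] show "(case p of (u, v) \<Rightarrow> u @ v) \<in> lists A"
        unfolding case_prod_unfold .
    qed
    have "carrier (free_algebra A) = {f. finite {w. f w \<noteq> 0} \<and> {w. f w \<noteq> 0} \<subseteq> lists A}"
      by (simp add: free_algebra_def)
    then show "x \<otimes>\<^bsub>free_algebra A\<^esub> y \<in> carrier (free_algebra A)"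
      by (simp only: mem_Collect_eq finite_subset[OF supp fin] order_trans[OF supp lists] simp_thms)
  next
    show "\<one>\<^bsub>free_algebra A\<^esub> \<in> carrier (free_algebra A)"
      by (auto simp: free_algebra_def)
  next
    fix x y z :: "'a list \<Rightarrow> complex"
    have "(\<Sum>(s, v) | s @ v = w. (\<Sum>(t, u) | t @ u = s. x t * y u) * z v) =
          (\<Sum>(t, s) | t @ s = w. x t * (\<Sum>(u, v) | u @ v = s. y u * z v))" for w
    proof -
      have "(\<Sum>(s, v) | s @ v = w. (\<Sum>(t, u) | t @ u = s. x t * y u) * z v) =
            (\<Sum>p\<in>{(s, v). s @ v = w}. \<Sum>r\<in>{(t, u). t @ u = fst p}.
               x (fst r) * y (snd r) * z (snd p))"
        by (simp only: case_prod_unfold sum_distrib_right)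
      also have "\<dots> = (\<Sum>(p, r)\<in>Sigma {(s, v). s @ v = w} (\<lambda>p. {(t, u). t @ u = fst p}).
               x (fst r) * y (snd r) * z (snd p))"
        by (rule sum.Sigma) (simp_all only: finite_splits ball_triv simp_thms ball_simps)
      also have "\<dots> = (\<Sum>(p, r)\<in>Sigma {(t, s). t @ s = w} (\<lambda>p. {(u, v). u @ v = snd p}).
               x (fst p) * (y (fst r) * z (snd r)))"
        by (rule sum.reindex_bij_witness[where
              i = "\<lambda>(p, r). ((fst p @ fst r, snd r), (fst p, fst r))" and
              j = "\<lambda>(p, r). ((fst r, snd r @ snd p), (snd r, snd p))"]) auto
      also have "\<dots> = (\<Sum>p\<in>{(t, s). t @ s = w}. \<Sum>r\<in>{(u, v). u @ v = snd p}.
               x (fst p) * (y (fst r) * z (snd r)))"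
        by (rule sum.Sigma[symmetric]) (simp_all only: finite_splits ball_triv simp_thms ball_simps)
      also have "\<dots> = (\<Sum>(t, s) | t @ s = w. x t * (\<Sum>(u, v) | u @ v = s. y u * z v))"
        by (simp only: case_prod_unfold sum_distrib_left)
      finally show ?thesis .
    qed
    then show "x \<otimes>\<^bsub>free_algebra A\<^esub> y \<otimes>\<^bsub>free_algebra A\<^esub> z =
               x \<otimes>\<^bsub>free_algebra A\<^esub> (y \<otimes>\<^bsub>free_algebra A\<^esub> z)"
      by (simp add: free_algebra_def)
  next
    fix x :: "'a list \<Rightarrow> complex"
    have "(\<Sum>(u, v) | u @ v = w. (if u = [] then 1 else 0) * x v) = x w" for w
    proof -
      have "(\<Sum>(u, v) | u @ v = w. (if u = [] then 1 else 0) * x v) =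
            (\<Sum>(u, v)\<in>{([] :: 'a list, w)}. (if u = [] then 1 else 0) * x v)"
        by (rule sum.mono_neutral_right) (auto simp: finite_splits split: if_splits)
      then show ?thesis by simp
    qed
    then show "\<one>\<^bsub>free_algebra A\<^esub> \<otimes>\<^bsub>free_algebra A\<^esub> x = x"
      by (simp add: free_algebra_def)
    have "(\<Sum>(u, v) | u @ v = w. x u * (if v = [] then 1 else 0)) = x w" for w
    proof -
      have "(\<Sum>(u, v) | u @ v = w. x u * (if v = [] then 1 else 0)) =
            (\<Sum>(u, v)\<in>{(w, [] :: 'a list)}. x u * (if v = [] then 1 else 0))"
        by (rule sum.mono_neutral_right) (auto simp: finite_splits split: if_splits)
      then show ?thesis by simp
    qed
    then show "x \<otimes>\<^bsub>free_algebra A\<^esub> \<one>\<^bsub>free_algebra A\<^esub> = x"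
      by (simp add: free_algebra_def)
  qed
next
  fix x y z :: "'a list \<Rightarrow> complex"
  show "(x \<oplus>\<^bsub>free_algebra A\<^esub> y) \<otimes>\<^bsub>free_algebra A\<^esub> z =
        x \<otimes>\<^bsub>free_algebra A\<^esub> z \<oplus>\<^bsub>free_algebra A\<^esub> y \<otimes>\<^bsub>free_algebra A\<^esub> z"
    by (simp add: free_algebra_def case_prod_unfold distrib_right distrib_left sum.distrib)
  show "z \<otimes>\<^bsub>free_algebra A\<^esub> (x \<oplus>\<^bsub>free_algebra A\<^esub> y) =
        z \<otimes>\<^bsub>free_algebra A\<^esub> x \<oplus>\<^bsub>free_algebra A\<^esub> z \<otimes>\<^bsub>free_algebra A\<^esub> y"
    by (simp add: free_algebra_def case_prod_unfold distrib_right distrib_left sum.distrib)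
qed

lemma free_scalar_closed: "free_scalar c \<in> carrier (free_algebra A)"
  by (auto simp: free_algebra_def free_scalar_def)

lemma free_gen_closed: "i \<in> A \<Longrightarrow> free_gen i \<in> carrier (free_algebra A)"
  by (auto simp: free_algebra_def free_gen_def)

section \<open>The Hecke algebra of the symmetric group\<close>

definition hecke_relators :: "nat \<Rightarrow> real \<Rightarrow> (nat list \<Rightarrow> complex) set" where
  "hecke_relators n q =
     (let F = free_algebra {1..<n}; T = free_gen in
       {(T i \<ominus>\<^bsub>F\<^esub> free_scalar (of_real q)) \<otimes>\<^bsub>F\<^esub> (T i \<oplus>\<^bsub>F\<^esub> \<one>\<^bsub>F\<^esub>) | i. i \<in> {1..<n}} \<union>
       {(T i \<otimes>\<^bsub>F\<^esub> T (Suc i) \<otimes>\<^bsub>F\<^esub> T i) \<ominus>\<^bsub>F\<^esub> (T (Suc i) \<otimes>\<^bsub>F\<^esub> T i \<otimes>\<^bsub>F\<^esub> T (Suc i)) | i.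
          i \<in> {1..<n} \<and> Suc i \<in> {1..<n}} \<union>
       {(T i \<otimes>\<^bsub>F\<^esub> T j) \<ominus>\<^bsub>F\<^esub> (T j \<otimes>\<^bsub>F\<^esub> T i) | i j.
          i \<in> {1..<n} \<and> j \<in> {1..<n} \<and> \<bar>int i - int j\<bar> \<ge> 2})"

lemma hecke_relators_closed: "hecke_relators n q \<subseteq> carrier (free_algebra {1..<n})"
proof -
  interpret ring "free_algebra {1..<n}" by (rule free_algebra_ring)
  show ?thesis
    unfolding hecke_relators_def Let_def
    by (auto simp del: One_nat_def intro!: m_closed a_closed minus_closed one_closed
          free_scalar_closed free_gen_closed)
qed

definition hecke_ideal :: "nat \<Rightarrow> real \<Rightarrow> (nat list \<Rightarrow> complex) set" where
  "hecke_ideal n q = Idl\<^bsub>free_algebra {1..<n}\<^esub> (hecke_relators n q)"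

lemma hecke_ideal_ideal: "ideal (hecke_ideal n q) (free_algebra {1..<n})"
  unfolding hecke_ideal_def
  by (rule ring.genideal_ideal[OF free_algebra_ring hecke_relators_closed])

definition hecke_algebra :: "nat \<Rightarrow> real \<Rightarrow> (nat list \<Rightarrow> complex) set ring" where
  "hecke_algebra n q = free_algebra {1..<n} Quot hecke_ideal n q"

lemma hecke_algebra_ring: "ring (hecke_algebra n q)"
  unfolding hecke_algebra_def by (rule ideal.quotient_is_ring[OF hecke_ideal_ideal])

definition hecke_class :: "nat \<Rightarrow> real \<Rightarrow> (nat list \<Rightarrow> complex) \<Rightarrow> (nat list \<Rightarrow> complex) set" where
  "hecke_class n q f = hecke_ideal n q +>\<^bsub>free_algebra {1..<n}\<^esub> f"

definition hecke_scalar :: "nat \<Rightarrow> real \<Rightarrow> complex \<Rightarrow> (nat list \<Rightarrow> complex) set" where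
  "hecke_scalar n q c = hecke_class n q (free_scalar c)"

definition hecke_gen :: "nat \<Rightarrow> real \<Rightarrow> nat \<Rightarrow> (nat list \<Rightarrow> complex) set" where
  "hecke_gen n q i = hecke_class n q (free_gen i)"

definition hecke_word :: "nat \<Rightarrow> real \<Rightarrow> nat list \<Rightarrow> (nat list \<Rightarrow> complex) set" where
  "hecke_word n q is =
     foldr (\<lambda>i x. hecke_gen n q i \<otimes>\<^bsub>hecke_algebra n q\<^esub> x) is \<one>\<^bsub>hecke_algebra n q\<^esub>"

definition word_perm :: "nat list \<Rightarrow> nat \<Rightarrow> nat" where
  "word_perm is = foldr (\<lambda>i p. Transposition.transpose i (Suc i) \<circ> p) is id"

definition reduced_word :: "nat \<Rightarrow> (nat \<Rightarrow> nat) \<Rightarrow> nat list \<Rightarrow> bool" where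
  "reduced_word n \<sigma> is \<longleftrightarrow> is \<in> lists {1..<n} \<and> word_perm is = \<sigma> \<and>
     (\<forall>js \<in> lists {1..<n}. word_perm js = \<sigma> \<longrightarrow> length is \<le> length js)"

text \<open>
  Meaningful when \<open>\<sigma>\<close> permutes \<open>{1..n}\<close>; the choice of the reduced word is immaterial
  (Matsumoto's theorem).
\<close>

definition hecke_T :: "nat \<Rightarrow> real \<Rightarrow> (nat \<Rightarrow> nat) \<Rightarrow> (nat list \<Rightarrow> complex) set" where
  "hecke_T n q \<sigma> = hecke_word n q (SOME is. reduced_word n \<sigma> is)"

definition hecke_linear_form :: "nat \<Rightarrow> real \<Rightarrow> ((nat list \<Rightarrow> complex) set \<Rightarrow> complex) \<Rightarrow> bool" where
  "hecke_linear_form n q \<phi> \<longleftrightarrow>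
     (\<forall>x \<in> carrier (hecke_algebra n q). \<forall>y \<in> carrier (hecke_algebra n q).
        \<phi> (x \<oplus>\<^bsub>hecke_algebra n q\<^esub> y) = \<phi> x + \<phi> y) \<and>
     (\<forall>c. \<forall>x \<in> carrier (hecke_algebra n q).
        \<phi> (hecke_scalar n q c \<otimes>\<^bsub>hecke_algebra n q\<^esub> x) = c * \<phi> x)"

definition canonical_trace :: "nat \<Rightarrow> real \<Rightarrow> (nat list \<Rightarrow> complex) set \<Rightarrow> complex" where
  "canonical_trace n q =
     (THE \<tau>. \<tau> \<in> extensional (carrier (hecke_algebra n q)) \<and> hecke_linear_form n q \<tau> \<and>
        (\<forall>\<sigma>. \<sigma> permutes {1..n} \<longrightarrow> \<tau> (hecke_T n q \<sigma>) = (if \<sigma> = id then 1 else 0)))"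

section \<open>Irreducible representations and their characters\<close>

definition hecke_rep ::
  "nat \<Rightarrow> real \<Rightarrow> nat \<Rightarrow> ((nat list \<Rightarrow> complex) set \<Rightarrow> complex mat) \<Rightarrow> bool" where
  "hecke_rep n q d \<rho> \<longleftrightarrow>
     \<rho> \<in> Ring.ring_hom (hecke_algebra n q) (ring_mat TYPE(complex) d ()) \<and>
     (\<forall>c. \<rho> (hecke_scalar n q c) = c \<cdot>\<^sub>m 1\<^sub>m d)"

definition hecke_irrep ::
  "nat \<Rightarrow> real \<Rightarrow> nat \<Rightarrow> ((nat list \<Rightarrow> complex) set \<Rightarrow> complex mat) \<Rightarrow> bool" where
  "hecke_irrep n q d \<rho> \<longleftrightarrow> hecke_rep n q d \<rho> \<and> d > 0 \<and>
     (\<forall>W. VectorSpace.subspace class_ring W (module_vec TYPE(complex) d) \<and>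
          (\<forall>x \<in> carrier (hecke_algebra n q). \<forall>v \<in> W. \<rho> x *\<^sub>v v \<in> W) \<longrightarrow>
        W = {0\<^sub>v d} \<or> W = carrier_vec d)"

text \<open>Indices of the elementary transpositions lying in the Young subgroup of type \<open>lam\<close>.\<close>

definition young_generators :: "nat \<Rightarrow> nat list \<Rightarrow> nat set" where
  "young_generators n lam = {1..<n} - {sum_list (take k lam) | k. k \<le> length lam}"

text \<open>
  At \<open>q = 1\<close> the algebra is the group algebra of the symmetric group, and the irreducible
  representation of type \<open>lam\<close> is the unique common constituent of the representation induced
  from the trivial character of the Young subgroup of type \<open>lam\<close> and of the one induced from
  the sign character of the Young subgroup of the conjugate type.  By Frobenius reciprocity this
  says that it contains a nonzero invariant vector of the former subgroup and a nonzero
  sign vector of the latter; so \<open>(n)\<close> labels the trivial representation.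
\<close>

definition sym_irrep_of_type ::
  "nat \<Rightarrow> nat list \<Rightarrow> nat \<Rightarrow> ((nat list \<Rightarrow> complex) set \<Rightarrow> complex mat) \<Rightarrow> bool" where
  "sym_irrep_of_type n lam d \<rho> \<longleftrightarrow> hecke_irrep n 1 d \<rho> \<and>
     (\<exists>v \<in> carrier_vec d. v \<noteq> 0\<^sub>v d \<and>
        (\<forall>i \<in> young_generators n lam. \<rho> (hecke_gen n 1 i) *\<^sub>v v = v)) \<and>
     (\<exists>v \<in> carrier_vec d. v \<noteq> 0\<^sub>v d \<and>
        (\<forall>i \<in> young_generators n (conjugate_partition lam). \<rho> (hecke_gen n 1 i) *\<^sub>v v = - v))"

text \<open>
  \<open>\<rho>\<close> is a model of the irreducible representation labelled by \<open>lam\<close>: it is joined to the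
  representation of type \<open>lam\<close> of the symmetric group by a family of representations whose
  matrices depend continuously on the parameter \<open>t\<close> of the algebra.
\<close>

definition hecke_irrep_of_type ::
  "nat \<Rightarrow> real \<Rightarrow> nat list \<Rightarrow> nat \<Rightarrow> ((nat list \<Rightarrow> complex) set \<Rightarrow> complex mat) \<Rightarrow> bool" where
  "hecke_irrep_of_type n q lam d \<rho> \<longleftrightarrow> hecke_irrep n q d \<rho> \<and>
     (\<exists>R. R q = \<rho> \<and> sym_irrep_of_type n lam d (R 1) \<and>
        (\<forall>t>0. hecke_rep n t d (R t)) \<and>
        (\<forall>i \<in> {1..<n}. \<forall>a<d. \<forall>b<d.
           continuous_on {0<..} (\<lambda>t. R t (hecke_gen n t i) $$ (a, b))))"

definition normalized_character ::
  "nat \<Rightarrow> ((nat list \<Rightarrow> complex) set \<Rightarrow> complex mat) \<Rightarrow> (nat list \<Rightarrow> complex) set \<Rightarrow> complex" where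
  "normalized_character d \<rho> x = (\<Sum>i<d. \<rho> x $$ (i, i)) / of_nat d"

section \<open>The q-Plancherel measure\<close>

text \<open>
  \<open>V lam\<close>, of dimension \<open>d lam\<close>, stands for the irreducible representation labelled by \<open>lam\<close>.
  Irreducible characters being linearly independent, at most one \<open>M\<close> has this property, and it
  does not depend on the chosen models of the representations.
\<close>

definition is_q_plancherel ::
  "nat \<Rightarrow> real \<Rightarrow> (nat list \<Rightarrow> nat) \<Rightarrow> (nat list \<Rightarrow> (nat list \<Rightarrow> complex) set \<Rightarrow> complex mat) \<Rightarrow>
   nat list pmf \<Rightarrow> bool" where
  "is_q_plancherel n q d V M \<longleftrightarrow> set_pmf M \<subseteq> int_partitions n \<and>
     (\<forall>x \<in> carrier (hecke_algebra n q).
        canonical_trace n q x =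
          (\<Sum>lam \<in> int_partitions n.
             of_real (pmf M lam) * normalized_character (d lam) (V lam) x))"

section \<open>The permutations attached to a partition, and convergence in probability\<close>

text \<open>
  \<open>cycle_of_list [a, b, c]\<close> sends \<open>a\<close> to \<open>b\<close>, \<open>b\<close> to \<open>c\<close> and \<open>c\<close> to \<open>a\<close>; products of permutations are
  compositions, so the cycle on \<open>[1..<Suc k]\<close> has the reduced word \<open>[1..<k]\<close>.
\<close>

fun consecutive_cycles :: "nat \<Rightarrow> nat list \<Rightarrow> nat \<Rightarrow> nat" where
  "consecutive_cycles a [] = id"
| "consecutive_cycles a (m # ms) =
     cycle_of_list [Suc a..<Suc (a + m)] \<circ> consecutive_cycles (a + m) ms"

definition partition_perm :: "nat list \<Rightarrow> nat \<Rightarrow> nat" where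
  "partition_perm mu = consecutive_cycles 0 mu"

text \<open>
  The random variables live on different spaces.  The limit is allowed to depend on \<open>n\<close> because
  the canonical trace of \<open>T\<^sub>\<mu>\<close> is formally computed in a different algebra for each \<open>n\<close>.
\<close>

definition converges_in_probability ::
  "(nat \<Rightarrow> 'a pmf) \<Rightarrow> (nat \<Rightarrow> 'a \<Rightarrow> 'b :: metric_space) \<Rightarrow> (nat \<Rightarrow> 'b) \<Rightarrow> bool" where
  "converges_in_probability M X c \<longleftrightarrow>
     (\<forall>\<epsilon>>0. (\<lambda>n. measure_pmf.prob (M n) {x. dist (X n x) (c n) > \<epsilon>}) \<longlonglongrightarrow> 0)"

end

theory Submission
  imports Defs
begin

text \<open>
  Let \<open>w\<close> be a nonempty word without repeated letters, all of them less than \<open>l\<close>.  Its translates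
  \<open>w\<^sub>0, \<dots>, w\<^sub>N\<^sub>-\<^sub>1\<close> by multiples of \<open>l\<close>, where \<open>N = n div l\<close>, represent elements conjugate to
  \<open>T\<^sub>w\<close> by powers of the unit \<open>T\<^sub>1 \<cdots> T\<^sub>n\<^sub>-\<^sub>1\<close>, so a character takes the same value at all of them.
  As \<open>q > 0\<close>, every representation is unitary for the involution reversing words, and the
  Cauchy-Schwarz inequality for the average \<open>a\<close> of the \<open>T\<^sub>w\<^sub>j\<close> gives
  \<open>\<bar>\<chi>(T\<^sub>w)\<bar>\<^sup>2 = \<bar>\<chi>(a)\<bar>\<^sup>2 \<le> \<chi>(a\<^sup>* a)\<close>.  Averaging over the Plancherel measure turns \<open>\<chi>\<close> into the
  canonical trace, which vanishes on the mixed products since these involve some generator exactly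
  once; hence the second moment of \<open>\<chi>(T\<^sub>w)\<close> is at most \<open>C / N\<close>, with \<open>C\<close> independent of \<open>n\<close>.

  A linear form on the algebra is handled through its values on words; Matsumoto's theorem, in the
  form that these values agree on all reduced words of a permutation, determines the canonical trace.
\<close>

section \<open>Words in the elementary transpositions\<close>

text \<open>The estimate has to be uniform in n. Its constant is C =
  \<open>Re (unit_coeff q (rev w @ w))\<close>, and \<open>unit_coeff\<close> does not refer to n,
  because its operators act on functions of arbitrary maps \<open>nat \<Rightarrow> nat\<close>
  instead of the group algebra of one symmetric group. Distinctness of the letters is used twice:
  such a word is reduced, so it represents a basis element, and a letter of one translate occurs
  exactly once in a product with another translate. The permutation attached to a partition has such
  a word because its cycles act on consecutive intervals. Positivity of q makes the weights q^(-
  length) of the invariant inner product positive, and it makes the letters invertible, which the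
  conjugation of translates requires.\<close>

lemma word_perm_Nil [simp]: "word_perm [] = id"
  by (simp add: word_perm_def)

lemma word_perm_Cons [simp]:
  "word_perm (i # w) = Transposition.transpose i (Suc i) \<circ> word_perm w"
  by (simp add: word_perm_def)

lemma word_perm_append [simp]: "word_perm (u @ v) = word_perm u \<circ> word_perm v"
  by (induction u) (simp_all add: comp_assoc)

lemma transpose_comp_cancel [simp]:
  "Transposition.transpose a b \<circ> (Transposition.transpose a b \<circ> f) = f"
  by (simp flip: comp_assoc)

lemma word_perm_rev_comp [simp]: "word_perm (rev w) \<circ> word_perm w = id"
proof (induction w)
  case (Cons i w)
  then show ?case by (simp add: comp_assoc)
qed simp

lemma word_perm_comp_rev [simp]: "word_perm w \<circ> word_perm (rev w) = id"
  using word_perm_rev_comp[of "rev w"] by simp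

lemma bij_word_perm: "bij (word_perm w)"
  by (rule o_bij[OF word_perm_rev_comp word_perm_comp_rev])

lemma word_perm_rev_cong: "word_perm (rev u) = word_perm (rev v)" if "word_perm u = word_perm v"
  using that by (metis comp_assoc comp_id id_comp word_perm_comp_rev word_perm_rev_comp)

lemma word_perm_rev_neq: "word_perm (rev w) x \<noteq> word_perm (rev w) y" if "x \<noteq> y"
  using bij_word_perm[of "rev w"] that by (metis bij_def injD)

lemma word_perm_permutes: "word_perm w permutes {1..n}" if "w \<in> lists {1..<n}"
  using that
proof (induction w)
  case (Cons i w)
  then have "Transposition.transpose i (Suc i) permutes {1..n}"
    by (intro permutes_swap_id) auto
  with Cons show ?case unfolding word_perm_Cons by (intro permutes_compose) auto
qed (simp only: word_perm_Nil permutes_id)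

text \<open>The strong exchange condition. As \<open>word_perm (rev w)\<close> is the inverse of
  \<open>word_perm w\<close>, the premise says that this inverse reverses the pair x < y. Pulling
  the transposition through the first letter a conjugates it and keeps the pair ordered, except when
  the pair is a, \<open>Suc a\<close>; then a itself is the letter to delete.\<close>

lemma word_exchange:
  assumes "x < y" "word_perm (rev w) x > word_perm (rev w) y"
  shows "\<exists>w'. set w' \<subseteq> set w \<and> Suc (length w') = length w \<and>
           word_perm w' = Transposition.transpose x y \<circ> word_perm w"
  using assms
proof (induction w arbitrary: x y)
  case (Cons a v)
  let ?s = "Transposition.transpose a (Suc a)"
  have less: "word_perm (rev v) (?s x) > word_perm (rev v) (?s y)"
    using Cons.prems by simp
  show ?case
  proof (cases "?s x < ?s y")
    case True
    from Cons.IH[OF this less] obtain v' where v': "set v' \<subseteq> set v" "Suc (length v') = length v"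
      "word_perm v' = Transposition.transpose (?s x) (?s y) \<circ> word_perm v" by blast
    have "?s \<circ> Transposition.transpose (?s x) (?s y) = Transposition.transpose x y \<circ> ?s"
      by (auto simp: fun_eq_iff Transposition.transpose_def)
    then have "word_perm (a # v') = Transposition.transpose x y \<circ> word_perm (a # v)"
      by (simp add: v'(3) flip: comp_assoc)
    then show ?thesis using v' by (intro exI[of _ "a # v'"]) auto
  next
    case False
    with Cons.prems(1) have "x = a" "y = Suc a"
      by (auto simp: Transposition.transpose_def split: if_splits)
    then have "word_perm v = Transposition.transpose x y \<circ> word_perm (a # v)"
      by simp
    then show ?thesis by (metis length_Cons set_subset_Cons)
  qed
qed simp

section \<open>Reduced words and descents\<close>

lemma reduced_wordI:
  assumes "w \<in> lists {1..<n}" "word_perm w = \<sigma>"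
    and "\<And>v. v \<in> lists {1..<n} \<Longrightarrow> word_perm v = \<sigma> \<Longrightarrow> length w \<le> length v"
  shows "reduced_word n \<sigma> w"
  using assms by (auto simp: reduced_word_def)

lemma reduced_wordD:
  assumes "reduced_word n \<sigma> w"
  shows "w \<in> lists {1..<n}" "word_perm w = \<sigma>"
    and "\<And>v. v \<in> lists {1..<n} \<Longrightarrow> word_perm v = \<sigma> \<Longrightarrow> length w \<le> length v"
  using assms by (auto simp: reduced_word_def)

lemma reduced_word_length_eq:
  assumes "reduced_word n \<sigma> u" "reduced_word n \<sigma> v"
  shows "length u = length v"
  using reduced_wordD(1,2)[OF assms(1)] reduced_wordD(1,2)[OF assms(2)]
    reduced_wordD(3)[OF assms(1)] reduced_wordD(3)[OF assms(2)] by (simp add: le_antisym)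

lemma reduced_word_Nil: "reduced_word n id []"
  by (rule reduced_wordI) auto

text \<open>Exchange at the descent i deletes some letter of w, and putting i in front restores both
  the permutation and the length.\<close>

lemma reduced_word_descent:
  assumes w: "reduced_word n \<sigma> w" and i: "i \<in> {1..<n}"
    and desc: "word_perm (rev w) i > word_perm (rev w) (Suc i)"
  shows "\<exists>z. reduced_word n \<sigma> (i # z)"
proof -
  note w' = reduced_wordD[OF w]
  from word_exchange[OF _ desc] obtain z where z: "set z \<subseteq> set w" "Suc (length z) = length w"
    "word_perm z = Transposition.transpose i (Suc i) \<circ> word_perm w" by auto
  have "word_perm (i # z) = \<sigma>"
    using z(3) w'(2) by simp
  then have "reduced_word n \<sigma> (i # z)"
    using z w' i by (intro reduced_wordI) auto
  then show ?thesis ..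
qed

text \<open>Every word u for the new permutation has a descent at i, so exchange shortens u to a
  word for \<sigma>, which has at least as many letters as v.\<close>

lemma reduced_word_ConsI:
  assumes v: "reduced_word n \<sigma> v" and i: "i \<in> {1..<n}"
    and asc: "word_perm (rev v) i < word_perm (rev v) (Suc i)"
  shows "reduced_word n (Transposition.transpose i (Suc i) \<circ> \<sigma>) (i # v)"
proof (rule reduced_wordI)
  note v' = reduced_wordD[OF v]
  show "i # v \<in> lists {1..<n}" "word_perm (i # v) = Transposition.transpose i (Suc i) \<circ> \<sigma>"
    using v' i by auto
  fix u assume u: "u \<in> lists {1..<n}" "word_perm u = Transposition.transpose i (Suc i) \<circ> \<sigma>"
  then have "word_perm u = word_perm (i # v)" using v' by simp
  then have "word_perm (rev u) = word_perm (rev v) \<circ> Transposition.transpose i (Suc i)"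
    by (drule_tac word_perm_rev_cong) simp
  then have "word_perm (rev u) i > word_perm (rev u) (Suc i)"
    using asc by simp
  from word_exchange[OF _ this] obtain z where z: "set z \<subseteq> set u" "Suc (length z) = length u"
    "word_perm z = Transposition.transpose i (Suc i) \<circ> word_perm u" by auto
  have "word_perm z = \<sigma>" "z \<in> lists {1..<n}"
    using z u by auto
  then show "length (i # v) \<le> length u"
    using v'(3)[of z] z(2) by simp
qed

lemma reduced_word_ConsD:
  assumes "reduced_word n \<sigma> (i # v)"
  shows "i \<in> {1..<n}" "reduced_word n (Transposition.transpose i (Suc i) \<circ> \<sigma>) v"
    and "word_perm (rev v) i < word_perm (rev v) (Suc i)"
proof -
  let ?s = "Transposition.transpose i (Suc i)"
  note w = reduced_wordD[OF assms]
  show i: "i \<in> {1..<n}" using w by simp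
  have \<sigma>: "?s \<circ> \<sigma> = word_perm v" using w(2) by auto
  show v: "reduced_word n (?s \<circ> \<sigma>) v"
  proof (rule reduced_wordI)
    fix u assume "u \<in> lists {1..<n}" "word_perm u = ?s \<circ> \<sigma>"
    then have "length (i # v) \<le> length (i # u)"
      using i by (intro w(3)) auto
    then show "length v \<le> length u" by simp
  qed (use w \<sigma> in auto)
  show "word_perm (rev v) i < word_perm (rev v) (Suc i)"
  \<comment> \<open>With a descent at i the tail would have a reduced word \<open>i # z\<close>. The
    two letters i of \<open>i # i # z\<close> cancel, so z would be a word for \<sigma> with two
    letters fewer than \<open>i # v\<close>.\<close>
  proof (rule ccontr)
    assume "\<not> ?thesis"
    then have "word_perm (rev v) i > word_perm (rev v) (Suc i)"
      using word_perm_rev_neq[of i "Suc i" v] by force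
    from reduced_word_descent[OF v i this] obtain z where z: "reduced_word n (?s \<circ> \<sigma>) (i # z)" ..
    note z' = reduced_wordD[OF z] and v' = reduced_wordD[OF v]
    have "word_perm z = ?s \<circ> (?s \<circ> word_perm z)" by simp
    also have "?s \<circ> word_perm z = ?s \<circ> \<sigma>" using z'(2) by simp
    finally have "word_perm z = \<sigma>" by simp
    then have "length (i # v) \<le> length z" using w(3) z'(1) by simp
    moreover have "length (i # z) \<le> length v" using z'(3)[OF v'(1,2)] .
    ultimately show False by simp
  qed
qed

lemma word_perm_transpose:
  assumes "a < b" "1 \<le> a" "b \<le> n"
  shows "\<exists>w \<in> lists {1..<n}. word_perm w = Transposition.transpose a b"
proof -
  have "b = a + k \<Longrightarrow> a < b \<Longrightarrow> b \<le> n \<Longrightarrow> ?thesis" for k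
  proof (induction k arbitrary: b)
    case (Suc k)
    show ?case
    proof (cases k)
      case 0
      then show ?thesis using Suc.prems assms(2) by (intro bexI[of _ "[a]"]) auto
    next
      case (Suc m)
      with Suc.IH[of "a + k"] Suc.prems obtain w where
        w: "w \<in> lists {1..<n}" "word_perm w = Transposition.transpose a (a + k)" by auto
      have "word_perm ([a + k] @ w @ [a + k]) = Transposition.transpose a b"
        using Suc Suc.prems by (auto simp: w(2) fun_eq_iff Transposition.transpose_def)
      then show ?thesis using w(1) Suc.prems assms(2)
        by (intro bexI[of _ "[a + k] @ w @ [a + k]"]) auto
    qed
  qed simp
  from this[of "b - a"] assms show ?thesis by auto
qed

lemma word_perm_surj:
  assumes "\<sigma> permutes {1..n}"
  shows "\<exists>w \<in> lists {1..<n}. word_perm w = \<sigma>"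
  using assms finite_atLeastAtMost
proof (induction rule: permutes_induct)
  case id
  then show ?case by (intro bexI[of _ "[]"]) auto
next
  case (swap a b p)
  obtain v where v: "v \<in> lists {1..<n}" "word_perm v = Transposition.transpose a b"
    using word_perm_transpose[of a b n] word_perm_transpose[of b a n] swap
    by (metis atLeastAtMost_iff linorder_neqE_nat transpose_commute)
  from swap obtain w where "w \<in> lists {1..<n}" "word_perm w = p" by auto
  with v show ?case by (intro bexI[of _ "v @ w"]) auto
qed

lemma reduced_word_exists:
  assumes "\<sigma> permutes {1..n}"
  shows "\<exists>w. reduced_word n \<sigma> w"
proof -
  from word_perm_surj[OF assms] obtain w where "w \<in> lists {1..<n} \<and> word_perm w = \<sigma>" by blast
  from ex_has_least_nat[where P = "\<lambda>w. w \<in> lists {1..<n} \<and> word_perm w = \<sigma>", OF this, of length]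
  show ?thesis by (auto simp: reduced_word_def)
qed

section \<open>Functions on words that respect the Hecke relations\<close>

text \<open>A linear form on the Hecke algebra, seen through its values on words. The relations are
  imposed inside every context u, v because a form that kills the relators alone need not kill the
  two-sided ideal they generate.\<close>

definition hecke_functional :: "nat \<Rightarrow> real \<Rightarrow> (nat list \<Rightarrow> complex) \<Rightarrow> bool" where
  "hecke_functional n q g \<longleftrightarrow> (\<forall>u \<in> lists {1..<n}. \<forall>v \<in> lists {1..<n}.
     (\<forall>i \<in> {1..<n}. g (u @ i # i # v) = (of_real q - 1) * g (u @ i # v) + of_real q * g (u @ v)) \<and>
     (\<forall>i \<in> {1..<n}. Suc i < n \<longrightarrow>
        g (u @ i # Suc i # i # v) = g (u @ Suc i # i # Suc i # v)) \<and>
     (\<forall>i \<in> {1..<n}. \<forall>j \<in> {1..<n}. Suc i < j \<longrightarrow> g (u @ i # j # v) = g (u @ j # i # v)))"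

lemma hecke_functionalD:
  assumes "hecke_functional n q g" "u \<in> lists {1..<n}" "v \<in> lists {1..<n}"
  shows "i \<in> {1..<n} \<Longrightarrow> g (u @ i # i # v) = (of_real q - 1) * g (u @ i # v) + of_real q * g (u @ v)"
    and "i \<in> {1..<n} \<Longrightarrow> Suc i < n \<Longrightarrow> g (u @ i # Suc i # i # v) = g (u @ Suc i # i # Suc i # v)"
    and "i \<in> {1..<n} \<Longrightarrow> j \<in> {1..<n} \<Longrightarrow> Suc i < j \<Longrightarrow> g (u @ i # j # v) = g (u @ j # i # v)"
  using assms unfolding hecke_functional_def by blast+

lemma hecke_functional_append:
  assumes "hecke_functional n q g" "x \<in> lists {1..<n}"
  shows "hecke_functional n q (\<lambda>w. g (x @ w))"
proof -
  have app: "x @ u \<in> lists {1..<n}" if "u \<in> lists {1..<n}" for u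
    using that assms(2) by simp
  note D = hecke_functionalD[OF assms(1) app, unfolded append_assoc]
  show ?thesis
    unfolding hecke_functional_def using D by (intro ballI conjI impI)
qed

text \<open>Reversal fixes the quadratic and braid relations, up to the exchange of the contexts,
  and swaps the two sides of a commutation.\<close>

lemma hecke_functional_rev:
  assumes "hecke_functional n q g"
  shows "hecke_functional n q (\<lambda>w. g (rev w))"
proof -
  have rev: "rev w \<in> lists {1..<n}" if "w \<in> lists {1..<n}" for w
    using that by auto
  note D = hecke_functionalD[OF assms rev rev]
  show ?thesis
    unfolding hecke_functional_def using D(1) D(2) D(3)[symmetric] by simp
qed

text \<open>Matsumoto's theorem: the two first letters are both descents of \<open>\<sigma>\<close>, so \<open>\<sigma>\<close> has reduced words
  starting with either side of the relation between them.\<close>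

lemma hecke_functional_reduced_word_unique:
  assumes "hecke_functional n q g" "reduced_word n \<sigma> u" "reduced_word n \<sigma> v"
  shows "g u = g v"
  using assms
proof (induction "length u" arbitrary: g \<sigma> u v rule: less_induct)
  case less
  note g = less.prems(1) and u = reduced_wordD[OF less.prems(2)] and v = reduced_wordD[OF less.prems(3)]
  have len: "length u = length v" using reduced_word_length_eq[OF less.prems(2,3)] .
  show ?case
  proof (cases u)
    case Nil
    then show ?thesis using len by simp
  next
    case (Cons i u')
    then obtain j v' where v_eq: "v = j # v'" using len by (cases v) auto
    let ?s = "\<lambda>i. Transposition.transpose i (Suc i)"
    let ?p = "word_perm (rev u)"
    have pv: "word_perm (rev v) = ?p" using word_perm_rev_cong u v by metis
    have p_desc: "?p (Suc k) < ?p k" if "reduced_word n \<sigma> (k # z)" for k z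
    proof -
      note r = reduced_wordD[OF that] reduced_word_ConsD[OF that]
      have "?p = word_perm (rev (k # z))" using word_perm_rev_cong r u by metis
      then show ?thesis using r by simp
    qed
    note ru = less.prems(2)[unfolded Cons] and rv = less.prems(3)[unfolded v_eq]
    have i: "i \<in> {1..<n}" and j: "j \<in> {1..<n}" using reduced_word_ConsD[OF ru] reduced_word_ConsD[OF rv] by auto
    have gen: "h x = h y" if "hecke_functional n q h" "reduced_word n \<tau> x" "reduced_word n \<tau> y" "length x < length u"
      for h \<tau> x y using less.hyps that by blast
    \<comment> \<open>Absorbing the common first letter k into the function gives another
      \<open>hecke_functional\<close>, so the induction hypothesis applies to the tails; this is why
      g is generalized in the induction.\<close>
    have step: "g (k # x) = g (k # y)" if "reduced_word n \<sigma> (k # x)" "reduced_word n \<sigma> (k # y)" for k x y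
    proof -
      have "length (k # x) = length u"
        using reduced_word_length_eq[OF that(1) less.prems(2)] .
      then have "length x < length u" by simp
      moreover have "hecke_functional n q (\<lambda>w. g ([k] @ w))"
        using g reduced_word_ConsD(1)[OF that(1)] by (intro hecke_functional_append) auto
      ultimately show ?thesis
        using gen[of "\<lambda>w. g ([k] @ w)", OF _ reduced_word_ConsD(2)[OF that(1)] reduced_word_ConsD(2)[OF that(2)]]
        by simp
    qed
    \<comment> \<open>Once k is removed, the inverse of the remaining permutation is
      \<open>?p \<circ> ?s k\<close>, and the second premise says that l is a descent there.\<close>
    have cons: "\<exists>y. reduced_word n \<sigma> (k # l # y)"
      if "reduced_word n \<sigma> (k # x)" "?p (?s k l) > ?p (?s k (Suc l))" "l \<in> {1..<n}" for k l x
    proof -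
      note r = reduced_word_ConsD[OF that(1)]
      have "word_perm (rev x) = word_perm (rev (k # x)) \<circ> ?s k"
        by (simp add: comp_assoc)
      also have "word_perm (rev (k # x)) = ?p"
        using reduced_wordD[OF that(1)] u word_perm_rev_cong by metis
      finally have "word_perm (rev x) = ?p \<circ> ?s k" .
      then have desc: "word_perm (rev x) l > word_perm (rev x) (Suc l)" using that by simp
      from reduced_word_descent[OF r(2) that(3) desc] obtain y where y: "reduced_word n (?s k \<circ> \<sigma>) (l # y)" ..
      have "word_perm (l # y) = word_perm x" using reduced_wordD[OF y] reduced_wordD[OF r(2)] by simp
      then have "word_perm (k # l # y) = word_perm (k # x)" by simp
      moreover have "length (l # y) = length x"
        using reduced_word_length_eq[OF y r(2)] .
      ultimately have "reduced_word n \<sigma> (k # l # y)"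
        using reduced_wordD[OF that(1)] reduced_wordD[OF y] by (intro reduced_wordI) auto
      then show ?thesis ..
    qed
    have comm: "g (k # x) = g (l # y)"
      if "reduced_word n \<sigma> (k # x)" "reduced_word n \<sigma> (l # y)" "Suc k < l" for k l x y
    proof -
      have l: "l \<in> {1..<n}" and k: "k \<in> {1..<n}" using reduced_word_ConsD that by blast+
      have "?p (?s k l) > ?p (?s k (Suc l))"
        using p_desc[OF that(2)] that(3) by (simp add: Transposition.transpose_def)
      from cons[OF that(1) this l] obtain z where z: "reduced_word n \<sigma> (k # l # z)" ..
      note z' = reduced_wordD[OF z]
      have "?s k \<circ> ?s l = ?s l \<circ> ?s k"
        using that(3) by (auto simp: fun_eq_iff Transposition.transpose_def)
      then have "word_perm (l # k # z) = word_perm (k # l # z)"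
        by (simp flip: comp_assoc)
      then have z2: "reduced_word n \<sigma> (l # k # z)"
        using z' by (intro reduced_wordI) auto
      have "g (k # l # z) = g (l # k # z)"
        using hecke_functionalD(3)[OF g, of "[]" z k l] k l that(3) z' by simp
      then show ?thesis
        using step[OF that(1) z] step[OF that(2) z2] by simp
    qed
    have braid: "g (k # x) = g (Suc k # y)"
      if "reduced_word n \<sigma> (k # x)" "reduced_word n \<sigma> (Suc k # y)" for k x y
    proof -
      have l: "Suc k \<in> {1..<n}" and k: "k \<in> {1..<n}" using reduced_word_ConsD that by blast+
      \<comment> \<open>Both letters are descents, so \<open>?p\<close> decreases along k, k+1, k+2.
        Hence k+1 is still a descent after k is stripped, and k again after both are, which produces
        one side of the braid relation; the other side has the same permutation and length.\<close>
      note d = p_desc[OF that(1)] p_desc[OF that(2)]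
      have "?p (?s k (Suc k)) > ?p (?s k (Suc (Suc k)))"
        using d by (simp add: Transposition.transpose_def)
      from cons[OF that(1) this l] obtain x' where x': "reduced_word n \<sigma> (k # Suc k # x')" ..
      note r = reduced_word_ConsD[OF x']
      note rr = reduced_word_ConsD[OF r(2)]
      have "word_perm (rev x') = word_perm (rev (k # Suc k # x')) \<circ> ?s k \<circ> ?s (Suc k)"
        by (simp add: comp_assoc)
      also have "word_perm (rev (k # Suc k # x')) = ?p"
        using reduced_wordD[OF x'] u word_perm_rev_cong by metis
      finally have "word_perm (rev x') = ?p \<circ> ?s k \<circ> ?s (Suc k)" .
      then have desc: "word_perm (rev x') k > word_perm (rev x') (Suc k)"
        using d by (simp add: Transposition.transpose_def)
      from reduced_word_descent[OF rr(2) k desc] obtain z where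
        z: "reduced_word n (?s (Suc k) \<circ> (?s k \<circ> \<sigma>)) (k # z)" ..
      have "word_perm (k # z) = word_perm x'" using reduced_wordD[OF z] reduced_wordD[OF rr(2)] by simp
      then have "word_perm (k # Suc k # k # z) = word_perm (k # Suc k # x')" by simp
      moreover have "length (k # z) = length x'"
        using reduced_word_length_eq[OF z rr(2)] .
      ultimately have z1: "reduced_word n \<sigma> (k # Suc k # k # z)"
        using reduced_wordD[OF x'] reduced_wordD[OF z] by (intro reduced_wordI) auto
      note z' = reduced_wordD[OF z1]
      have "?s k \<circ> ?s (Suc k) \<circ> ?s k = ?s (Suc k) \<circ> ?s k \<circ> ?s (Suc k)"
        by (auto simp: fun_eq_iff Transposition.transpose_def)
      then have "word_perm (Suc k # k # Suc k # z) = word_perm (k # Suc k # k # z)"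
        by (simp flip: comp_assoc)
      then have z2: "reduced_word n \<sigma> (Suc k # k # Suc k # z)"
        using z' by (intro reduced_wordI) auto
      have "g (k # Suc k # k # z) = g (Suc k # k # Suc k # z)"
        using hecke_functionalD(2)[OF g, of "[]" z k] k l z' by simp
      then show ?thesis
        using step[OF that(1) z1] step[OF that(2) z2] by simp
    qed
    consider "i = j" | "Suc i < j" | "Suc j < i" | "j = Suc i" | "i = Suc j" by linarith
    then show ?thesis
    proof cases
      case 1
      then show ?thesis using step ru rv unfolding Cons v_eq by metis
    next
      case 2
      then show ?thesis using comm[OF ru rv] unfolding Cons v_eq by simp
    next
      case 3
      then show ?thesis using comm[OF rv ru] unfolding Cons v_eq by simp
    next
      case 4
      then show ?thesis using braid ru rv unfolding Cons v_eq by simp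
    next
      case 5
      then show ?thesis using braid[OF rv] ru unfolding Cons v_eq by simp
    qed
  qed
qed

text \<open>Every word can be rewritten into reduced ones. The inner induction lengthens a suffix v.
  Where \<open>i # v\<close> stops being reduced, Matsumoto's theorem lets v be replaced by a word
  starting with i, and the quadratic relation turns the square of i into two shorter words, covered
  by the outer induction.\<close>

lemma hecke_functional_eqI:
  assumes g: "hecke_functional n q g" and h: "hecke_functional n q h"
    and eq: "\<And>\<sigma>. \<sigma> permutes {1..n} \<Longrightarrow> \<exists>w. reduced_word n \<sigma> w \<and> g w = h w"
    and w: "w \<in> lists {1..<n}"
  shows "g w = h w"
proof -
  have red: "g v = h v" if "reduced_word n \<sigma> v" for \<sigma> v
  proof -
    have "\<sigma> permutes {1..n}"
      using word_perm_permutes reduced_wordD[OF that] by blast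
    from eq[OF this] obtain v' where "reduced_word n \<sigma> v'" "g v' = h v'" by blast
    then show ?thesis
      using hecke_functional_reduced_word_unique[OF g that] hecke_functional_reduced_word_unique[OF h that]
      by simp
  qed
  show ?thesis using w
  proof (induction "length w" arbitrary: w rule: less_induct)
    case less
    have "(\<exists>\<sigma>. reduced_word n \<sigma> v) \<or> g w = h w" if "w = u @ v" for u v
      using that
    proof (induction v arbitrary: u)
      case Nil
      then show ?case using reduced_word_Nil by blast
    next
      case (Cons i v)
      then have u: "u \<in> lists {1..<n}" and i: "i \<in> {1..<n}" and v: "v \<in> lists {1..<n}"
        using less.prems Cons.prems by auto
      from Cons.IH[of "u @ [i]"] Cons.prems consider "g w = h w"
        | \<sigma> where "reduced_word n \<sigma> v" by auto
      then show ?case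
      proof cases
        case 2
        show ?thesis
        proof (cases "word_perm (rev v) i < word_perm (rev v) (Suc i)")
          case True
          from reduced_word_ConsI[OF 2 i this] show ?thesis by blast
        next
          case False
          then have "word_perm (rev v) i > word_perm (rev v) (Suc i)"
            using word_perm_rev_neq[of i "Suc i" v] by force
          from reduced_word_descent[OF 2 i this] obtain z where z: "reduced_word n \<sigma> (i # z)" ..
          have zl: "z \<in> lists {1..<n}" using reduced_wordD[OF z] by simp
          have len: "length (i # z) = length v"
            using reduced_word_length_eq[OF z 2] .
          have exp: "f w = (of_real q - 1) * f (u @ i # z) + of_real q * f (u @ z)" if "hecke_functional n q f" for f :: "nat list \<Rightarrow> complex"
          proof -
            have "hecke_functional n q (\<lambda>x. f ((u @ [i]) @ x))"
              using that u i by (intro hecke_functional_append) auto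
            then have "f ((u @ [i]) @ v) = f ((u @ [i]) @ i # z)"
              by (rule hecke_functional_reduced_word_unique[OF _ 2 z])
            then show ?thesis
              using hecke_functionalD(1)[OF that u zl i] Cons.prems by simp
          qed
          have "g (u @ i # z) = h (u @ i # z)" "g (u @ z) = h (u @ z)"
            using u i zl len Cons.prems by (auto intro!: less.hyps)
          then show ?thesis using exp[OF g] exp[OF h] by simp
        qed
      qed simp
    qed
    from this[of "[]"] show ?case using red by auto
  qed
qed

text \<open>Only the letter i moves points across the cut between i and
  \<open>Suc i\<close>.\<close>

lemma word_perm_le_iff: "word_perm w x \<le> i \<longleftrightarrow> x \<le> i" if "i \<notin> set w"
  using that by (induction w) (auto simp: Transposition.transpose_def)

text \<open>The tail omits its predecessor i, so the inverse of its permutation respects the cut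
  after i, and i is an ascent.\<close>

lemma distinct_reduced_word:
  assumes "distinct w" "w \<in> lists {1..<n}"
  shows "reduced_word n (word_perm w) w"
  using assms
proof (induction w)
  case Nil
  show ?case using reduced_word_Nil by (simp only: word_perm_Nil)
next
  case (Cons i w)
  then have "word_perm (rev w) i \<le> i" "\<not> word_perm (rev w) (Suc i) \<le> i"
    by (simp_all add: word_perm_le_iff)
  with Cons show ?case unfolding word_perm_Cons by (intro reduced_word_ConsI) auto
qed

section \<open>The regular representation\<close>

text \<open>
  The regular representation, with \<open>T\<^sub>\<sigma>\<close> written as the indicator function of the inverse of \<open>\<sigma>\<close>.
  The relations hold for arbitrary functions \<open>p\<close>, not only for permutations.
\<close>

definition hecke_op :: "real \<Rightarrow> nat \<Rightarrow> ((nat \<Rightarrow> nat) \<Rightarrow> complex) \<Rightarrow> (nat \<Rightarrow> nat) \<Rightarrow> complex" where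
  "hecke_op q i f p =
     (if p i \<le> p (Suc i) then of_real q * f (p \<circ> Transposition.transpose i (Suc i))
      else f (p \<circ> Transposition.transpose i (Suc i)) + (of_real q - 1) * f p)"

lemma hecke_op_linear:
  "hecke_op q i (\<lambda>p. a * f p + b * g p) = (\<lambda>p. a * hecke_op q i f p + b * hecke_op q i g p)"
  by (simp add: hecke_op_def fun_eq_iff algebra_simps)

lemma foldr_hecke_op_linear:
  "foldr (hecke_op q) w (\<lambda>p. a * f p + b * g p) =
     (\<lambda>p. a * foldr (hecke_op q) w f p + b * foldr (hecke_op q) w g p)"
  by (induction w) (simp_all add: hecke_op_linear)

lemma comp_transpose_id: "p \<circ> Transposition.transpose i j = p" if "p i = p j"
  using that by (auto simp: fun_eq_iff Transposition.transpose_def)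

text \<open>At a tie \<open>p i = p (Suc i)\<close> the transposition fixes p and the operator
  multiplies by q, a root of x^2 = (q - 1) x + q; so the relation survives for maps that are not
  injective.\<close>

lemma hecke_op_quadratic:
  "hecke_op q i (hecke_op q i f) = (\<lambda>p. (of_real q - 1) * hecke_op q i f p + of_real q * f p)"
proof (rule ext)
  fix p :: "nat \<Rightarrow> nat"
  consider "p i < p (Suc i)" | "p i = p (Suc i)" | "p i > p (Suc i)" by linarith
  then show "hecke_op q i (hecke_op q i f) p = (of_real q - 1) * hecke_op q i f p + of_real q * f p"
    by cases (simp_all add: hecke_op_def comp_assoc comp_transpose_id[of p] algebra_simps)
qed

lemma hecke_op_commute:
  assumes "Suc i < j"
  shows "hecke_op q i (hecke_op q j f) = hecke_op q j (hecke_op q i f)"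
proof (rule ext)
  fix p :: "nat \<Rightarrow> nat"
  have "Transposition.transpose j (Suc j) \<circ> Transposition.transpose i (Suc i) =
      Transposition.transpose i (Suc i) \<circ> Transposition.transpose j (Suc j)"
    using assms by (auto simp: fun_eq_iff Transposition.transpose_def)
  then show "hecke_op q i (hecke_op q j f) p = hecke_op q j (hecke_op q i f) p"
    using assms by (simp add: hecke_op_def comp_assoc) (simp add: algebra_simps)
qed

lemma hecke_op_braid:
  "hecke_op q i (hecke_op q (Suc i) (hecke_op q i f)) =
   hecke_op q (Suc i) (hecke_op q i (hecke_op q (Suc i) f))"
proof (rule ext)
  fix p :: "nat \<Rightarrow> nat"
  let ?s = "Transposition.transpose i (Suc i)" and ?t = "Transposition.transpose (Suc i) (Suc (Suc i))"
  have braid: "?t \<circ> (?s \<circ> ?t) = ?s \<circ> (?t \<circ> ?s)"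
    by (auto simp: fun_eq_iff Transposition.transpose_def)
  \<comment> \<open>Ties identify some of the six maps obtained from p by permuting i, i+1, i+2;
    \<open>ab\<close>, \<open>bc\<close> and \<open>ac\<close> record this for the three possible
    tied pairs.\<close>
  have ab: "p \<circ> ?s = p" "p \<circ> (?s \<circ> (?t \<circ> ?s)) = p \<circ> (?t \<circ> ?s)" "p \<circ> (?s \<circ> ?t) = p \<circ> ?t"
    if "p i = p (Suc i)"
    using comp_transpose_id[of p, OF that] by (simp_all flip: comp_assoc)
  have bc: "p \<circ> ?t = p" "p \<circ> (?s \<circ> (?t \<circ> ?s)) = p \<circ> (?s \<circ> ?t)" "p \<circ> (?t \<circ> ?s) = p \<circ> ?s"
    if "p (Suc i) = p (Suc (Suc i))"
  proof -
    show t: "p \<circ> ?t = p" using comp_transpose_id[of p, OF that] .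
    then show "p \<circ> (?t \<circ> ?s) = p \<circ> ?s" by (simp flip: comp_assoc)
    have "p \<circ> (?s \<circ> (?t \<circ> ?s)) = (p \<circ> ?t) \<circ> (?s \<circ> ?t)"
      by (simp only: comp_assoc braid)
    then show "p \<circ> (?s \<circ> (?t \<circ> ?s)) = p \<circ> (?s \<circ> ?t)" by (simp only: t)
  qed
  have ac: "p \<circ> (?s \<circ> (?t \<circ> ?s)) = p" "p \<circ> (?s \<circ> ?t) = p \<circ> ?s" "p \<circ> (?t \<circ> ?s) = p \<circ> ?t"
    if "p i = p (Suc (Suc i))"
    using comp_transpose_id[of "p \<circ> ?s" "Suc i" "Suc (Suc i)"] comp_transpose_id[of "p \<circ> ?t" i "Suc i"] that
    by (simp_all flip: comp_assoc) (simp add: comp_assoc)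
  note defs = hecke_op_def comp_assoc braid algebra_simps
  consider "p i < p (Suc i)" | "p i = p (Suc i)" | "p i > p (Suc i)" by linarith
  note 1 = this
  consider "p (Suc i) < p (Suc (Suc i))" | "p (Suc i) = p (Suc (Suc i))" | "p (Suc i) > p (Suc (Suc i))" by linarith
  note 2 = this
  consider "p i < p (Suc (Suc i))" | "p i = p (Suc (Suc i))" | "p i > p (Suc (Suc i))" by linarith
  note 3 = this
  show "hecke_op q i (hecke_op q (Suc i) (hecke_op q i f)) p =
      hecke_op q (Suc i) (hecke_op q i (hecke_op q (Suc i) f)) p"
    by (rule 1; rule 2; rule 3) (simp_all add: defs ab bc ac)
qed

lemma hecke_functional_foldr_hecke_op: "hecke_functional n q (\<lambda>w. foldr (hecke_op q) w f p)"
proof -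
  have "foldr (hecke_op q) (u @ i # i # v) f p =
      (of_real q - 1) * foldr (hecke_op q) (u @ i # v) f p + of_real q * foldr (hecke_op q) (u @ v) f p" for u i v
  proof -
    have "foldr (hecke_op q) (u @ i # i # v) f =
        foldr (hecke_op q) u (\<lambda>p. complex_of_real (of_real q - 1) * foldr (hecke_op q) (i # v) f p
                                + of_real q * foldr (hecke_op q) v f p)"
      by (simp add: hecke_op_quadratic)
    then show ?thesis by (simp add: foldr_hecke_op_linear)
  qed
  then show ?thesis
    unfolding hecke_functional_def by (simp add: hecke_op_braid) (metis hecke_op_commute)
qed

section \<open>The coefficient of the identity\<close>

text \<open>The word acts in the regular representation on the indicator of the identity, and the
  result is read at the identity: this is the coefficient of T_1 in the product of its
  letters.\<close>

definition unit_coeff :: "real \<Rightarrow> nat list \<Rightarrow> complex" where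
  "unit_coeff q w = foldr (hecke_op q) w (\<lambda>p. if p = id then 1 else 0) id"

lemma hecke_functional_unit_coeff: "hecke_functional n q (unit_coeff q)"
  unfolding unit_coeff_def by (rule hecke_functional_foldr_hecke_op)

lemma foldr_hecke_op_reduced:
  assumes "reduced_word n \<sigma> w"
  shows "foldr (hecke_op q) w (\<lambda>p. if p = id then 1 else 0) =
           (\<lambda>p. if p = word_perm (rev w) then 1 else 0)"
  using assms
proof (induction w arbitrary: \<sigma>)
  case (Cons i v)
  note r = reduced_word_ConsD[OF Cons.prems]
  let ?s = "Transposition.transpose i (Suc i)"
  have iff: "p \<circ> ?s = word_perm (rev v) \<longleftrightarrow> p = word_perm (rev v) \<circ> ?s" for p
  proof
    assume "p \<circ> ?s = word_perm (rev v)"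
    then have "(p \<circ> ?s) \<circ> ?s = word_perm (rev v) \<circ> ?s" by simp
    then show "p = word_perm (rev v) \<circ> ?s" by (simp add: comp_assoc)
  qed (simp add: comp_assoc)
  show ?case
  proof (rule ext)
    fix p
    have "foldr (hecke_op q) (i # v) (\<lambda>p. if p = id then 1 else 0) p =
        hecke_op q i (\<lambda>p. if p = word_perm (rev v) then 1 else 0) p"
      by (simp only: foldr_Cons comp_apply Cons.IH[OF r(2)])
    \<comment> \<open>The diagonal term with q - 1 occurs only where p decreases at i, whereas
      \<open>word_perm (rev v)\<close> increases there. So the indicator is transported with
      coefficient 1.\<close>
    also have "\<dots> = (if p = word_perm (rev v) \<circ> ?s then 1 else 0)"
    proof (cases "p i \<le> p (Suc i)")
      case True
      then have "p \<noteq> word_perm (rev v) \<circ> ?s" using r(3) by auto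
      then show ?thesis using True by (simp add: hecke_op_def iff)
    next
      case False
      then have "p \<noteq> word_perm (rev v)" using r(3) by auto
      then show ?thesis using False by (simp add: hecke_op_def iff)
    qed
    finally show "foldr (hecke_op q) (i # v) (\<lambda>p. if p = id then 1 else 0) p =
        (if p = word_perm (rev (i # v)) then 1 else 0)" by simp
  qed
qed simp

lemma unit_coeff_reduced:
  assumes "reduced_word n \<sigma> w"
  shows "unit_coeff q w = (if \<sigma> = id then 1 else 0)"
proof -
  have "id = word_perm (rev w) \<longleftrightarrow> word_perm w = id"
    using word_perm_rev_comp[of w] word_perm_rev_cong[of w "[]"]
    by (metis id_comp rev.simps(1) word_perm_Nil)
  then show ?thesis
    using reduced_wordD(2)[OF assms] by (simp add: unit_coeff_def foldr_hecke_op_reduced[OF assms])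
qed

text \<open>
  The subgroup of the permutations stabilising \<open>{..i}\<close> is left by the letter \<open>i\<close> and cannot be reached again
  by means of the other letters.
\<close>

lemma unit_coeff_single_letter:
  assumes "i \<notin> set u" "i \<notin> set v"
  shows "unit_coeff q (u @ i # v) = 0"
proof -
  define Q where "Q p \<longleftrightarrow> (\<forall>x. p x \<le> i \<longleftrightarrow> x \<le> i)" for p :: "nat \<Rightarrow> nat"
  let ?d = "\<lambda>p. if p = id then 1 else 0 :: complex"
  have Q: "Q (p \<circ> Transposition.transpose a (Suc a)) \<longleftrightarrow> Q p" if "a \<noteq> i" for a p
  proof -
    have s: "Transposition.transpose a (Suc a) x \<le> i \<longleftrightarrow> x \<le> i" for x
      using that by (auto simp: Transposition.transpose_def)
    show ?thesis
    proof
      assume *: "Q p"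
      show "Q (p \<circ> Transposition.transpose a (Suc a))"
        using * s unfolding Q_def by simp
    next
      assume *: "Q (p \<circ> Transposition.transpose a (Suc a))"
      have "p x \<le> i \<longleftrightarrow> x \<le> i" for x
        using *[unfolded Q_def, rule_format, of "Transposition.transpose a (Suc a) x"] s by simp
      then show "Q p" by (simp add: Q_def)
    qed
  qed
  have v: "foldr (hecke_op q) v ?d p = 0" if "\<not> Q p" for p
    using assms(2) that
  proof (induction v arbitrary: p)
    case Nil
    have "Q id" by (simp add: Q_def)
    with Nil have "p \<noteq> id" by blast
    then show ?case by (subst foldr_Nil, subst id_apply) (rule if_not_P)
  next
    case (Cons a v)
    have "a \<noteq> i" "i \<notin> set v" using Cons.prems(1) by auto
    moreover have "\<not> Q (p \<circ> Transposition.transpose a (Suc a))"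
      using Q[OF \<open>a \<noteq> i\<close>] Cons.prems(2) by blast
    ultimately show ?case
      using Cons.IH Cons.prems(2) by (simp add: hecke_op_def)
  qed
  \<comment> \<open>On Q the map p increases at i, so \<open>hecke_op\<close> takes its first
    branch: there is no diagonal term, and the shifted argument lies outside Q, where the function
    built from v vanishes.\<close>
  have i: "foldr (hecke_op q) (i # v) ?d p = 0" if "Q p" for p
  proof -
    have p: "p i \<le> i" "\<not> p (Suc i) \<le> i" using that[unfolded Q_def, rule_format, of i]
      that[unfolded Q_def, rule_format, of "Suc i"] by simp_all
    have "\<not> Q (p \<circ> Transposition.transpose i (Suc i))"
    proof
      assume "Q (p \<circ> Transposition.transpose i (Suc i))"
      from this[unfolded Q_def, rule_format, of i] show False using p by simp
    qed
    then show ?thesis using p by (simp add: hecke_op_def v)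
  qed
  have "foldr (hecke_op q) (u @ i # v) ?d p = 0" if "Q p" for p
    using assms(1) that
  proof (induction u arbitrary: p)
    case Nil
    show ?case unfolding append_Nil by (rule i) (rule Nil.prems(2))
  next
    case (Cons a u)
    have "a \<noteq> i" "i \<notin> set u" using Cons.prems(1) by auto
    moreover have "Q (p \<circ> Transposition.transpose a (Suc a))"
      using Q[OF \<open>a \<noteq> i\<close>] Cons.prems(2) by blast
    ultimately show ?case
      using Cons.IH Cons.prems(2) by (simp add: hecke_op_def)
  qed
  moreover have "Q id" by (simp add: Q_def)
  ultimately show ?thesis unfolding unit_coeff_def .
qed

section \<open>Linear forms on the Hecke algebra\<close>

definition free_word :: "'a list \<Rightarrow> 'a list \<Rightarrow> complex" where
  "free_word w = (\<lambda>u. if u = w then 1 else 0)"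

text \<open>The linear extension of g, evaluated at f. The sum is 0 by convention when f has
  infinite support, hence the carrier assumptions in the rules of linearity.\<close>

definition word_lin :: "('a list \<Rightarrow> complex) \<Rightarrow> ('a list \<Rightarrow> complex) \<Rightarrow> complex" where
  "word_lin g f = (\<Sum>w | f w \<noteq> 0. f w * g w)"

lemma free_algebra_carrierD:
  assumes "f \<in> carrier (free_algebra A)"
  shows "finite {w. f w \<noteq> 0}" "\<And>w. f w \<noteq> 0 \<Longrightarrow> w \<in> lists A"
  using assms by (auto simp: free_algebra_def)

lemma word_lin_eq_sum:
  assumes "finite S" "{w. f w \<noteq> 0} \<subseteq> S"
  shows "word_lin g f = (\<Sum>w\<in>S. f w * g w)"
  unfolding word_lin_def using assms by (intro sum.mono_neutral_left) auto

lemma word_lin_add: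
  assumes "f \<in> carrier (free_algebra A)" "h \<in> carrier (free_algebra A)"
  shows "word_lin g (f \<oplus>\<^bsub>free_algebra A\<^esub> h) = word_lin g f + word_lin g h"
proof -
  let ?S = "{w. f w \<noteq> 0} \<union> {w. h w \<noteq> 0}"
  have fin: "finite ?S"
    using free_algebra_carrierD(1)[OF assms(1)] free_algebra_carrierD(1)[OF assms(2)] by simp
  have add: "(f \<oplus>\<^bsub>free_algebra A\<^esub> h) w = f w + h w" for w
    by (simp add: free_algebra_def)
  have "word_lin g (f \<oplus>\<^bsub>free_algebra A\<^esub> h) = (\<Sum>w\<in>?S. (f \<oplus>\<^bsub>free_algebra A\<^esub> h) w * g w)"
    using fin by (intro word_lin_eq_sum) (auto simp: add)
  also have "\<dots> = (\<Sum>w\<in>?S. f w * g w) + (\<Sum>w\<in>?S. h w * g w)"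
    by (simp add: add distrib_right sum.distrib)
  also have "(\<Sum>w\<in>?S. f w * g w) = word_lin g f"
    using fin by (intro word_lin_eq_sum[symmetric]) auto
  also have "(\<Sum>w\<in>?S. h w * g w) = word_lin g h"
    using fin by (intro word_lin_eq_sum[symmetric]) auto
  finally show ?thesis .
qed

lemma word_lin_zero: "word_lin g \<zero>\<^bsub>free_algebra A\<^esub> = 0"
  by (simp add: word_lin_def free_algebra_def)

lemma word_lin_minus:
  assumes f: "f \<in> carrier (free_algebra A)" and h: "h \<in> carrier (free_algebra A)"
  shows "word_lin g (f \<ominus>\<^bsub>free_algebra A\<^esub> h) = word_lin g f - word_lin g h"
proof -
  interpret ring "free_algebra A" by (rule free_algebra_ring)
  have "word_lin g f = word_lin g ((f \<ominus>\<^bsub>free_algebra A\<^esub> h) \<oplus>\<^bsub>free_algebra A\<^esub> h)"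
    using f h by (simp add: minus_eq a_assoc l_neg)
  also have "\<dots> = word_lin g (f \<ominus>\<^bsub>free_algebra A\<^esub> h) + word_lin g h"
    using f h by (intro word_lin_add) auto
  finally show ?thesis by simp
qed

text \<open>Group the pairs of words by their concatenation. The nested form turns the factors of a
  product into contexts for g, so that relators can be evaluated letter by letter.\<close>

lemma word_lin_mult:
  assumes "f \<in> carrier (free_algebra A)" "h \<in> carrier (free_algebra A)"
  shows "word_lin g (f \<otimes>\<^bsub>free_algebra A\<^esub> h) = word_lin (\<lambda>u. word_lin (\<lambda>v. g (u @ v)) h) f"
proof -
  let ?P = "{w. f w \<noteq> 0} \<times> {w. h w \<noteq> 0}" and ?c = "\<lambda>(u, v). u @ v"
  let ?S = "?c ` ?P"
  have fin: "finite ?P"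
    using free_algebra_carrierD(1)[OF assms(1)] free_algebra_carrierD(1)[OF assms(2)] by simp
  have m: "(f \<otimes>\<^bsub>free_algebra A\<^esub> h) w = (\<Sum>(u, v)\<in>{p \<in> ?P. ?c p = w}. f u * h v)" for w
  proof -
    have "(f \<otimes>\<^bsub>free_algebra A\<^esub> h) w = (\<Sum>(u, v) | u @ v = w. f u * h v)"
      by (simp add: free_algebra_def)
    also have "\<dots> = (\<Sum>(u, v)\<in>{p \<in> ?P. ?c p = w}. f u * h v)"
      by (rule sum.mono_neutral_right) (auto simp: finite_splits)
    finally show ?thesis .
  qed
  have "word_lin g (f \<otimes>\<^bsub>free_algebra A\<^esub> h) = (\<Sum>w\<in>?S. (f \<otimes>\<^bsub>free_algebra A\<^esub> h) w * g w)"
  proof (rule word_lin_eq_sum)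
    show "{w. (f \<otimes>\<^bsub>free_algebra A\<^esub> h) w \<noteq> 0} \<subseteq> ?S"
    proof
      fix w assume "w \<in> {w. (f \<otimes>\<^bsub>free_algebra A\<^esub> h) w \<noteq> 0}"
      then have "{p \<in> ?P. ?c p = w} \<noteq> {}"
        unfolding mem_Collect_eq m by (metis sum.empty)
      then show "w \<in> ?S" by blast
    qed
  qed (use fin in simp)
  also have "\<dots> = (\<Sum>w\<in>?S. \<Sum>p\<in>{p \<in> ?P. ?c p = w}. f (fst p) * h (snd p) * g (?c p))"
    by (simp add: m sum_distrib_right case_prod_unfold)
  also have "\<dots> = (\<Sum>p\<in>?P. f (fst p) * h (snd p) * g (?c p))"
    using fin by (intro sum.group) auto
  also have "\<dots> = (\<Sum>u | f u \<noteq> 0. \<Sum>v | h v \<noteq> 0. f u * h v * g (u @ v))"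
    by (simp add: sum.cartesian_product case_prod_unfold)
  also have "\<dots> = word_lin (\<lambda>u. word_lin (\<lambda>v. g (u @ v)) h) f"
    by (simp add: word_lin_def sum_distrib_left mult.assoc)
  finally show ?thesis .
qed

lemma word_lin_single [simp]:
  "word_lin g (free_word w) = g w"
  "word_lin g (free_gen i) = g [i]"
  "word_lin g (free_scalar c) = c * g []"
  "word_lin g \<one>\<^bsub>free_algebra A\<^esub> = g []"
proof -
  have *: "word_lin g (\<lambda>u. if u = w then c else 0) = c * g w" for c w
    by (subst word_lin_eq_sum[of "{w}"]) auto
  show "word_lin g (free_word w) = g w" using *[of w 1] by (simp add: free_word_def)
  show "word_lin g (free_gen i) = g [i]" using *[of "[i]" 1] by (simp add: free_gen_def)
  show "word_lin g (free_scalar c) = c * g []" using *[of "[]" c] by (simp add: free_scalar_def)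
  show "word_lin g \<one>\<^bsub>free_algebra A\<^esub> = g []" using *[of "[]" 1] by (simp add: free_algebra_def)
qed

lemma word_lin_fun_zero [simp]: "word_lin (\<lambda>w. 0) f = 0"
  by (simp add: word_lin_def)

lemma word_lin_cong:
  assumes "f \<in> carrier (free_algebra A)" "\<And>w. w \<in> lists A \<Longrightarrow> g w = h w"
  shows "word_lin g f = word_lin h f"
  unfolding word_lin_def using assms free_algebra_carrierD(2)[OF assms(1)] by (intro sum.cong) auto

lemma free_word_closed: "w \<in> lists A \<Longrightarrow> free_word w \<in> carrier (free_algebra A)"
  by (auto simp: free_algebra_def free_word_def)

lemma free_word_Nil: "free_word [] = \<one>\<^bsub>free_algebra A\<^esub>"
  by (simp add: free_word_def free_algebra_def)

lemma free_gen_mult_word: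
  "free_gen i \<otimes>\<^bsub>free_algebra A\<^esub> free_word w = free_word (i # w)"
proof
  fix x
  have "(free_gen i \<otimes>\<^bsub>free_algebra A\<^esub> free_word w) x = (\<Sum>(u, v) | u @ v = x. free_gen i u * free_word w v)"
    by (simp add: free_algebra_def)
  also have "\<dots> = (\<Sum>p \<in> (if i # w = x then {([i], w)} else {}). 1)"
    by (rule sum.mono_neutral_cong_right) (auto simp: finite_splits free_gen_def free_word_def split: if_splits)
  finally show "(free_gen i \<otimes>\<^bsub>free_algebra A\<^esub> free_word w) x = free_word (i # w) x"
    by (auto simp: free_word_def)
qed

lemma free_scalar_mult:
  "free_scalar c \<otimes>\<^bsub>free_algebra A\<^esub> f = (\<lambda>w. c * f w)" for f :: "'a list \<Rightarrow> complex"
proof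
  fix x
  have "(free_scalar c \<otimes>\<^bsub>free_algebra A\<^esub> f) x = (\<Sum>(u, v) | u @ v = x. free_scalar c u * f v)"
    by (simp add: free_algebra_def)
  also have "\<dots> = (\<Sum>p \<in> {([] :: 'a list, x)}. c * f (snd p))"
    by (rule sum.mono_neutral_cong_right) (auto simp: finite_splits free_scalar_def split: if_splits)
  finally show "(free_scalar c \<otimes>\<^bsub>free_algebra A\<^esub> f) x = c * f x" by simp
qed

section \<open>Functionals on words and linear forms on the quotient\<close>

text \<open>Each relator evaluates to the difference of the two sides of its relation. The
  commutation relators come with both orders of i and j, and these give the same equation.\<close>

lemma hecke_relators_lin:
  "(\<forall>r \<in> hecke_relators n q. word_lin g r = 0) \<longleftrightarrow>
     (\<forall>i \<in> {1..<n}. g [i, i] = (of_real q - 1) * g [i] + of_real q * g []) \<and>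
     (\<forall>i \<in> {1..<n}. Suc i < n \<longrightarrow> g [i, Suc i, i] = g [Suc i, i, Suc i]) \<and>
     (\<forall>i \<in> {1..<n}. \<forall>j \<in> {1..<n}. Suc i < j \<longrightarrow> g [i, j] = g [j, i])"
proof -
  interpret F: ring "free_algebra {1..<n}" by (rule free_algebra_ring)
  let ?F = "free_algebra {1..<n}"
  note closed = free_scalar_closed free_gen_closed F.one_closed F.m_closed F.a_closed F.minus_closed
  have rel1: "word_lin g ((free_gen i \<ominus>\<^bsub>?F\<^esub> free_scalar (of_real q)) \<otimes>\<^bsub>?F\<^esub> (free_gen i \<oplus>\<^bsub>?F\<^esub> \<one>\<^bsub>?F\<^esub>)) =
      g [i, i] - ((of_real q - 1) * g [i] + of_real q * g [])" if "i \<in> {1..<n}" for i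
    using that by (simp add: word_lin_mult[where A = "{1..<n}"] word_lin_add[where A = "{1..<n}"]
        word_lin_minus[where A = "{1..<n}"] closed algebra_simps del: One_nat_def)
  have rel2: "word_lin g ((free_gen i \<otimes>\<^bsub>?F\<^esub> free_gen j \<otimes>\<^bsub>?F\<^esub> free_gen i) \<ominus>\<^bsub>?F\<^esub>
        (free_gen j \<otimes>\<^bsub>?F\<^esub> free_gen i \<otimes>\<^bsub>?F\<^esub> free_gen j)) = g [i, j, i] - g [j, i, j]"
    if "i \<in> {1..<n}" "j \<in> {1..<n}" for i j
    using that by (simp add: word_lin_mult[where A = "{1..<n}"]
        word_lin_minus[where A = "{1..<n}"] closed del: One_nat_def)
  have rel3: "word_lin g ((free_gen i \<otimes>\<^bsub>?F\<^esub> free_gen j) \<ominus>\<^bsub>?F\<^esub> (free_gen j \<otimes>\<^bsub>?F\<^esub> free_gen i)) =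
      g [i, j] - g [j, i]" if "i \<in> {1..<n}" "j \<in> {1..<n}" for i j
    using that by (simp add: word_lin_mult[where A = "{1..<n}"]
        word_lin_minus[where A = "{1..<n}"] closed del: One_nat_def)
  show ?thesis (is "?L \<longleftrightarrow> ?R")
  proof
    assume L: ?L
    show ?R
    proof (intro conjI ballI impI)
      fix i assume i: "i \<in> {1..<n}"
      have "(free_gen i \<ominus>\<^bsub>?F\<^esub> free_scalar (of_real q)) \<otimes>\<^bsub>?F\<^esub> (free_gen i \<oplus>\<^bsub>?F\<^esub> \<one>\<^bsub>?F\<^esub>) \<in> hecke_relators n q"
        unfolding hecke_relators_def Let_def using i by blast
      then show "g [i, i] = (of_real q - 1) * g [i] + of_real q * g []"
        using L rel1[OF i] by simp
    next
      fix i assume i: "i \<in> {1..<n}" "Suc i < n"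
      then have j: "Suc i \<in> {1..<n}" by simp
      have "(free_gen i \<otimes>\<^bsub>?F\<^esub> free_gen (Suc i) \<otimes>\<^bsub>?F\<^esub> free_gen i) \<ominus>\<^bsub>?F\<^esub>
        (free_gen (Suc i) \<otimes>\<^bsub>?F\<^esub> free_gen i \<otimes>\<^bsub>?F\<^esub> free_gen (Suc i)) \<in> hecke_relators n q"
        unfolding hecke_relators_def Let_def using i(1) j by blast
      then show "g [i, Suc i, i] = g [Suc i, i, Suc i]"
        using L rel2[OF i(1) j] by simp
    next
      fix i j assume ij: "i \<in> {1..<n}" "j \<in> {1..<n}" "Suc i < j"
      then have "\<bar>int i - int j\<bar> \<ge> 2" by simp
      then have "(free_gen i \<otimes>\<^bsub>?F\<^esub> free_gen j) \<ominus>\<^bsub>?F\<^esub> (free_gen j \<otimes>\<^bsub>?F\<^esub> free_gen i) \<in> hecke_relators n q"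
        unfolding hecke_relators_def Let_def using ij(1,2) by blast
      then show "g [i, j] = g [j, i]"
        using L rel3[OF ij(1,2)] by simp
    qed
  next
    assume R: ?R
    show ?L
    proof
      fix r assume "r \<in> hecke_relators n q"
      then consider i where "i \<in> {1..<n}"
          "r = (free_gen i \<ominus>\<^bsub>?F\<^esub> free_scalar (of_real q)) \<otimes>\<^bsub>?F\<^esub> (free_gen i \<oplus>\<^bsub>?F\<^esub> \<one>\<^bsub>?F\<^esub>)"
        | i where "i \<in> {1..<n}" "Suc i \<in> {1..<n}"
          "r = (free_gen i \<otimes>\<^bsub>?F\<^esub> free_gen (Suc i) \<otimes>\<^bsub>?F\<^esub> free_gen i) \<ominus>\<^bsub>?F\<^esub>
               (free_gen (Suc i) \<otimes>\<^bsub>?F\<^esub> free_gen i \<otimes>\<^bsub>?F\<^esub> free_gen (Suc i))"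
        | i j where "i \<in> {1..<n}" "j \<in> {1..<n}" "\<bar>int i - int j\<bar> \<ge> 2"
          "r = (free_gen i \<otimes>\<^bsub>?F\<^esub> free_gen j) \<ominus>\<^bsub>?F\<^esub> (free_gen j \<otimes>\<^bsub>?F\<^esub> free_gen i)"
        unfolding hecke_relators_def Let_def by blast
      then show "word_lin g r = 0"
      proof cases
        case (1 i)
        then have "g [i, i] = (of_real q - 1) * g [i] + of_real q * g []" using R by blast
        then show ?thesis unfolding 1(2) rel1[OF 1(1)] by simp
      next
        case (2 i)
        then have "Suc i < n" by simp
        with 2(1) R have "g [i, Suc i, i] = g [Suc i, i, Suc i]" by blast
        then show ?thesis unfolding 2(3) rel2[OF 2(1,2)] by simp
      next
        case (3 i j)
        then have "Suc i < j \<or> Suc j < i" by linarith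
        with 3(1,2) R have "g [i, j] = g [j, i]" by metis
        then show ?thesis unfolding 3(4) rel3[OF 3(1,2)] by simp
      qed
    qed
  qed
qed

lemma hecke_functional_iff:
  "hecke_functional n q g \<longleftrightarrow> (\<forall>u \<in> lists {1..<n}. \<forall>v \<in> lists {1..<n}.
     \<forall>r \<in> hecke_relators n q. word_lin (\<lambda>w. g (u @ w @ v)) r = 0)"
  unfolding hecke_functional_def hecke_relators_lin by simp

lemma word_lin_uminus:
  assumes "f \<in> carrier (free_algebra A)"
  shows "word_lin g (\<ominus>\<^bsub>free_algebra A\<^esub> f) = - word_lin g f"
proof -
  interpret ring "free_algebra A" by (rule free_algebra_ring)
  have "word_lin g (\<zero>\<^bsub>free_algebra A\<^esub> \<ominus>\<^bsub>free_algebra A\<^esub> f) = - word_lin g f"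
    using assms by (simp add: word_lin_minus[where A = A] word_lin_zero)
  then show ?thesis using assms by (simp add: minus_eq)
qed

lemma word_lin_hecke_ideal:
  assumes g: "hecke_functional n q g" and f: "f \<in> hecke_ideal n q"
  shows "word_lin g f = 0"
proof -
  let ?A = "{1..<n}" and ?F = "free_algebra {1..<n}"
  interpret F: ring ?F by (rule free_algebra_ring)
  \<comment> \<open>Vanishing is required in all contexts so that K is an ideal: multiplication by a
    word on either side only lengthens u or v.\<close>
  define K where "K = {f \<in> carrier ?F. \<forall>u \<in> lists ?A. \<forall>v \<in> lists ?A. word_lin (\<lambda>w. g (u @ w @ v)) f = 0}"
  have K: "f \<in> carrier ?F" "word_lin (\<lambda>w. g (u @ w @ v)) f = 0"
    if "f \<in> K" "u \<in> lists ?A" "v \<in> lists ?A" for f u v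
    using that unfolding K_def by blast+
  have Kc: "f \<in> carrier ?F" if "f \<in> K" for f using that unfolding K_def by blast
  have K_I: "f \<in> K" if "f \<in> carrier ?F"
      "\<And>u v. u \<in> lists ?A \<Longrightarrow> v \<in> lists ?A \<Longrightarrow> word_lin (\<lambda>w. g (u @ w @ v)) f = 0" for f
    using that unfolding K_def by blast
  have "ideal K ?F"
  proof (rule idealI[OF F.ring_axioms])
    show "subgroup K (add_monoid ?F)"
    proof
      show "K \<subseteq> carrier (add_monoid ?F)" unfolding K_def by auto
      show "x \<otimes>\<^bsub>add_monoid ?F\<^esub> y \<in> K" if "x \<in> K" "y \<in> K" for x y
      proof -
        have "x \<oplus>\<^bsub>?F\<^esub> y \<in> K"
          using Kc[OF that(1)] Kc[OF that(2)] K(2)[OF that(1)] K(2)[OF that(2)]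
          by (intro K_I F.a_closed) (simp_all only: word_lin_add add_0_left)
        then show ?thesis by simp
      qed
      have "\<zero>\<^bsub>?F\<^esub> \<in> K"
        by (intro K_I F.zero_closed word_lin_zero)
      then show "\<one>\<^bsub>add_monoid ?F\<^esub> \<in> K" by simp
      show "inv\<^bsub>add_monoid ?F\<^esub> x \<in> K" if "x \<in> K" for x
      proof -
        have "\<ominus>\<^bsub>?F\<^esub> x \<in> K"
          using Kc[OF that] K(2)[OF that]
          by (intro K_I F.a_inv_closed) (simp_all only: word_lin_uminus neg_0_equal_iff_equal minus_zero)
        then show ?thesis by (simp add: a_inv_def)
      qed
    qed
  next
    fix a x assume a: "a \<in> K" and x: "x \<in> carrier ?F"
    have "word_lin (\<lambda>w. g (u @ w @ v)) (x \<otimes>\<^bsub>?F\<^esub> a) = 0" if "u \<in> lists ?A" "v \<in> lists ?A" for u v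
    proof -
      have "word_lin (\<lambda>w. g (u @ w @ v)) (x \<otimes>\<^bsub>?F\<^esub> a) =
          word_lin (\<lambda>s. word_lin (\<lambda>w. g ((u @ s) @ w @ v)) a) x"
        using x Kc[OF a] by (simp add: word_lin_mult)
      also have "\<dots> = word_lin (\<lambda>s. 0) x"
      proof (rule word_lin_cong[OF x])
        fix s assume "s \<in> lists ?A"
        then have "u @ s \<in> lists ?A" using that(1) by simp
        then show "word_lin (\<lambda>w. g ((u @ s) @ w @ v)) a = 0" using that(2) by (rule K(2)[OF a])
      qed
      finally show ?thesis by simp
    qed
    then show "x \<otimes>\<^bsub>?F\<^esub> a \<in> K" using x Kc[OF a] unfolding K_def by blast
    have "word_lin (\<lambda>w. g (u @ w @ v)) (a \<otimes>\<^bsub>?F\<^esub> x) = 0" if "u \<in> lists ?A" "v \<in> lists ?A" for u v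
    proof -
      have "word_lin (\<lambda>w. g (u @ w @ v)) (a \<otimes>\<^bsub>?F\<^esub> x) =
          word_lin (\<lambda>s. word_lin (\<lambda>w. g (u @ s @ w @ v)) x) a"
        using x Kc[OF a] by (simp add: word_lin_mult)
      also have "\<dots> = (\<Sum>s | a s \<noteq> 0. \<Sum>w | x w \<noteq> 0. x w * (a s * g (u @ s @ w @ v)))"
        by (simp add: word_lin_def sum_distrib_left mult.left_commute)
      also have "\<dots> = word_lin (\<lambda>w. word_lin (\<lambda>s. g (u @ s @ (w @ v))) a) x"
        by (subst sum.swap) (simp add: word_lin_def sum_distrib_left)
      also have "\<dots> = word_lin (\<lambda>w. 0) x"
      proof (rule word_lin_cong[OF x])
        fix w assume "w \<in> lists ?A"
        then have "w @ v \<in> lists ?A" using that(2) by simp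
        with that(1) show "word_lin (\<lambda>s. g (u @ s @ w @ v)) a = 0" by (rule K(2)[OF a])
      qed
      finally show ?thesis by simp
    qed
    then show "a \<otimes>\<^bsub>?F\<^esub> x \<in> K" using x Kc[OF a] unfolding K_def by blast
  qed
  moreover have "hecke_relators n q \<subseteq> K"
  proof
    fix r assume r: "r \<in> hecke_relators n q"
    show "r \<in> K"
    proof (rule K_I)
      show "r \<in> carrier ?F" using r hecke_relators_closed by blast
      fix u v assume "u \<in> lists ?A" "v \<in> lists ?A"
      then show "word_lin (\<lambda>w. g (u @ w @ v)) r = 0"
        using g[unfolded hecke_functional_iff] r by blast
    qed
  qed
  ultimately have "hecke_ideal n q \<subseteq> K"
    unfolding hecke_ideal_def by (rule F.genideal_minimal)
  then have "f \<in> K" using f by blast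
  from K(2)[OF this lists.Nil lists.Nil] show ?thesis by simp
qed

lemma hecke_class_hom:
  "hecke_class n q \<in> Ring.ring_hom (free_algebra {1..<n}) (hecke_algebra n q)"
  using ideal.rcos_ring_hom[OF hecke_ideal_ideal, of n q]
  unfolding hecke_class_def[abs_def] hecke_algebra_def .

lemmas hecke_class_simps =
  Ring.ring_hom_closed[OF hecke_class_hom] Ring.ring_hom_mult[OF hecke_class_hom]
  Ring.ring_hom_add[OF hecke_class_hom] Ring.ring_hom_one[OF hecke_class_hom]

lemma hecke_class_surj:
  assumes "x \<in> carrier (hecke_algebra n q)"
  obtains f where "f \<in> carrier (free_algebra {1..<n})" "x = hecke_class n q f"
  using assms unfolding hecke_algebra_def FactRing_def A_RCOSETS_def' hecke_class_def by auto

lemma hecke_class_eq_zero: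
  assumes "f \<in> hecke_ideal n q"
  shows "hecke_class n q f = \<zero>\<^bsub>hecke_algebra n q\<^esub>"
proof -
  interpret ideal "hecke_ideal n q" "free_algebra {1..<n}" by (rule hecke_ideal_ideal)
  show ?thesis
    using a_rcos_const[OF assms] by (simp add: hecke_class_def hecke_algebra_def FactRing_def)
qed

lemma hecke_class_eqD:
  assumes "hecke_class n q f = hecke_class n q h"
    "f \<in> carrier (free_algebra {1..<n})" "h \<in> carrier (free_algebra {1..<n})"
  shows "f \<ominus>\<^bsub>free_algebra {1..<n}\<^esub> h \<in> hecke_ideal n q"
  using assms ring.quotient_eq_iff_same_a_r_cos[OF free_algebra_ring hecke_ideal_ideal]
  unfolding hecke_class_def by blast

lemma hecke_word_class:
  assumes "w \<in> lists {1..<n}"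
  shows "hecke_word n q w = hecke_class n q (free_word w)"
  using assms
proof (induction w)
  case Nil
  then show ?case
    by (simp add: hecke_word_def hecke_class_simps free_word_Nil[of "{1..<n}"] del: One_nat_def)
next
  case (Cons i w)
  have "hecke_word n q (i # w) = hecke_class n q (free_gen i) \<otimes>\<^bsub>hecke_algebra n q\<^esub> hecke_class n q (free_word w)"
    using Cons.IH by (simp add: hecke_word_def hecke_gen_def)
  also have "\<dots> = hecke_class n q (free_gen i \<otimes>\<^bsub>free_algebra {1..<n}\<^esub> free_word w)"
    using Cons.hyps by (intro hecke_class_simps(2)[symmetric] free_gen_closed free_word_closed)
  finally show ?case by (simp only: free_gen_mult_word)
qed

lemma hecke_linear_formD:
  assumes "hecke_linear_form n q \<phi>"
  shows "x \<in> carrier (hecke_algebra n q) \<Longrightarrow> y \<in> carrier (hecke_algebra n q) \<Longrightarrow>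
           \<phi> (x \<oplus>\<^bsub>hecke_algebra n q\<^esub> y) = \<phi> x + \<phi> y"
    and "x \<in> carrier (hecke_algebra n q) \<Longrightarrow> \<phi> (hecke_scalar n q c \<otimes>\<^bsub>hecke_algebra n q\<^esub> x) = c * \<phi> x"
  using assms unfolding hecke_linear_form_def by blast+

lemma hecke_linear_form_zero:
  assumes "hecke_linear_form n q \<phi>"
  shows "\<phi> \<zero>\<^bsub>hecke_algebra n q\<^esub> = 0"
proof -
  interpret ring "hecke_algebra n q" by (rule hecke_algebra_ring)
  show ?thesis
    using hecke_linear_formD(1)[OF assms, of "\<zero>\<^bsub>hecke_algebra n q\<^esub>" "\<zero>\<^bsub>hecke_algebra n q\<^esub>"] by simp
qed

text \<open>Linearity lets the support be removed one word at a time, by splitting f into its term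
  at w and \<open>f(w := 0)\<close>.\<close>

lemma hecke_linear_form_class:
  assumes \<phi>: "hecke_linear_form n q \<phi>" and f: "f \<in> carrier (free_algebra {1..<n})"
  shows "\<phi> (hecke_class n q f) = word_lin (\<lambda>w. \<phi> (hecke_word n q w)) f"
proof -
  let ?F = "free_algebra {1..<n}"
  interpret F: ring ?F by (rule free_algebra_ring)
  have "\<phi> (hecke_class n q f) = word_lin (\<lambda>w. \<phi> (hecke_word n q w)) f"
    if "finite S" "{w. f w \<noteq> 0} \<subseteq> S" "f \<in> carrier ?F" for S f
    using that
  proof (induction S arbitrary: f rule: finite_induct)
    case empty
    then have f: "f = \<zero>\<^bsub>?F\<^esub>" by (auto simp: free_algebra_def)
    have "\<zero>\<^bsub>?F\<^esub> \<in> hecke_ideal n q"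
      by (rule additive_subgroup.zero_closed[OF ideal.axioms(1)[OF hecke_ideal_ideal]])
    then show ?case
      unfolding f by (simp only: hecke_class_eq_zero word_lin_zero hecke_linear_form_zero[OF \<phi>])
  next
    case (insert w S)
    show ?case
    proof (cases "f w = 0")
      case True
      then have "{w. f w \<noteq> 0} \<subseteq> S" using insert.prems(1) by auto
      then show ?thesis by (rule insert.IH[OF _ insert.prems(2)])
    next
      case False
      then have w: "w \<in> lists {1..<n}" using free_algebra_carrierD(2)[OF insert.prems(2)] by blast
      let ?m = "free_scalar (f w) \<otimes>\<^bsub>?F\<^esub> free_word w" and ?f = "f(w := 0)"
      have sub: "{u. ?f u \<noteq> 0} \<subseteq> {u. f u \<noteq> 0}" by auto
      have "finite {u. f u \<noteq> 0}" "{u. f u \<noteq> 0} \<subseteq> lists {1..<n}"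
        using insert.prems(2) by (simp_all add: free_algebra_def)
      from finite_subset[OF sub this(1)] order_trans[OF sub this(2)] have f': "?f \<in> carrier ?F"
        by (simp add: free_algebra_def)
      have m: "?m \<in> carrier ?F" using w by (intro F.m_closed free_scalar_closed free_word_closed)
      have eq: "f = ?m \<oplus>\<^bsub>?F\<^esub> ?f"
        unfolding free_scalar_mult by (auto simp: free_algebra_def free_word_def)
      have IH: "\<phi> (hecke_class n q ?f) = word_lin (\<lambda>w. \<phi> (hecke_word n q w)) ?f"
        by (rule insert.IH[OF _ f']) (use insert.prems(1) in auto)
      have "\<phi> (hecke_class n q ?m) = \<phi> (hecke_scalar n q (f w) \<otimes>\<^bsub>hecke_algebra n q\<^esub> hecke_word n q w)"
        unfolding hecke_scalar_def hecke_word_class[OF w]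
        by (simp only: hecke_class_simps(2) free_scalar_closed free_word_closed[OF w])
      also have "\<dots> = f w * \<phi> (hecke_word n q w)"
        unfolding hecke_word_class[OF w]
        by (intro hecke_linear_formD(2)[OF \<phi>] hecke_class_simps(1) free_word_closed[OF w])
      also have "\<dots> = word_lin (\<lambda>w. \<phi> (hecke_word n q w)) ?m"
        by (subst word_lin_mult[OF free_scalar_closed free_word_closed[OF w]]) simp
      finally have m': "\<phi> (hecke_class n q ?m) = word_lin (\<lambda>w. \<phi> (hecke_word n q w)) ?m" .
      have "\<phi> (hecke_class n q (?m \<oplus>\<^bsub>?F\<^esub> ?f)) = \<phi> (hecke_class n q ?m) + \<phi> (hecke_class n q ?f)"
        by (simp only: hecke_class_simps(3)[OF m f'] hecke_linear_formD(1)[OF \<phi>] hecke_class_simps(1) m f')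
      also have "\<dots> = word_lin (\<lambda>w. \<phi> (hecke_word n q w)) (?m \<oplus>\<^bsub>?F\<^esub> ?f)"
        by (simp only: word_lin_add[OF m f'] m' IH)
      finally show ?thesis by (simp only: eq[symmetric])
    qed
  qed
  from this[OF free_algebra_carrierD(1)[OF f] order_refl f] show ?thesis .
qed

lemma hecke_linear_form_functional:
  assumes \<phi>: "hecke_linear_form n q \<phi>"
  shows "hecke_functional n q (\<lambda>w. \<phi> (hecke_word n q w))"
  unfolding hecke_functional_iff
proof (intro ballI)
  let ?F = "free_algebra {1..<n}" and ?g = "\<lambda>w. \<phi> (hecke_word n q w)"
  interpret F: ring ?F by (rule free_algebra_ring)
  fix u v r assume u: "u \<in> lists {1..<n}" and v: "v \<in> lists {1..<n}" and r: "r \<in> hecke_relators n q"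
  note c = free_word_closed[OF u] free_word_closed[OF v]
  have rc: "r \<in> carrier ?F" using r hecke_relators_closed by blast
  have "r \<in> hecke_ideal n q"
    unfolding hecke_ideal_def using F.genideal_self[OF hecke_relators_closed] r by blast
  then have "free_word u \<otimes>\<^bsub>?F\<^esub> (r \<otimes>\<^bsub>?F\<^esub> free_word v) \<in> hecke_ideal n q"
    using c by (intro ideal.I_l_closed[OF hecke_ideal_ideal] ideal.I_r_closed[OF hecke_ideal_ideal])
  then have "word_lin ?g (free_word u \<otimes>\<^bsub>?F\<^esub> (r \<otimes>\<^bsub>?F\<^esub> free_word v)) = 0"
    using hecke_linear_form_class[OF \<phi>] hecke_class_eq_zero hecke_linear_form_zero[OF \<phi>] c rc
    by (metis F.m_closed)
  moreover have "word_lin ?g (free_word u \<otimes>\<^bsub>?F\<^esub> (r \<otimes>\<^bsub>?F\<^esub> free_word v)) = word_lin (\<lambda>w. ?g (u @ w @ v)) r"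
    using c rc by (simp add: word_lin_mult[where A = "{1..<n}"] del: One_nat_def)
  ultimately show "word_lin (\<lambda>w. ?g (u @ w @ v)) r = 0" by simp
qed

lemma hecke_linear_form_exists:
  assumes g: "hecke_functional n q g"
  obtains \<phi> where "\<phi> \<in> extensional (carrier (hecke_algebra n q))" "hecke_linear_form n q \<phi>"
    "\<And>w. w \<in> lists {1..<n} \<Longrightarrow> \<phi> (hecke_word n q w) = g w"
proof -
  let ?F = "free_algebra {1..<n}"
  interpret F: ring ?F by (rule free_algebra_ring)
  interpret H: ring "hecke_algebra n q" by (rule hecke_algebra_ring)
  \<comment> \<open>The value does not depend on the chosen representative, by
    \<open>word_lin_hecke_ideal\<close>. The restriction to the carrier matches the extensionality
    in the description of \<open>canonical_trace\<close>.\<close>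
  define \<phi> where "\<phi> = restrict (\<lambda>x. word_lin g (SOME f. f \<in> carrier ?F \<and> hecke_class n q f = x))
    (carrier (hecke_algebra n q))"
  have cls: "\<phi> (hecke_class n q f) = word_lin g f" if f: "f \<in> carrier ?F" for f
  proof -
    let ?h = "SOME h. h \<in> carrier ?F \<and> hecke_class n q h = hecke_class n q f"
    have h: "?h \<in> carrier ?F \<and> hecke_class n q ?h = hecke_class n q f"
      by (rule someI[of _ f]) (use f in blast)
    then have "word_lin g (?h \<ominus>\<^bsub>?F\<^esub> f) = 0"
      using f by (intro word_lin_hecke_ideal[OF g] hecke_class_eqD) auto
    then have "word_lin g ?h = word_lin g f"
      using h f by (simp add: word_lin_minus[where A = "{1..<n}"] del: One_nat_def)
    then show ?thesis using hecke_class_simps(1)[OF f] by (simp add: \<phi>_def)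
  qed
  have "hecke_linear_form n q \<phi>"
    unfolding hecke_linear_form_def
  proof (intro conjI ballI allI)
    fix x y assume "x \<in> carrier (hecke_algebra n q)" "y \<in> carrier (hecke_algebra n q)"
    then obtain f h where "f \<in> carrier ?F" "x = hecke_class n q f" "h \<in> carrier ?F" "y = hecke_class n q h"
      by (metis hecke_class_surj)
    then show "\<phi> (x \<oplus>\<^bsub>hecke_algebra n q\<^esub> y) = \<phi> x + \<phi> y"
      by (metis cls hecke_class_simps(3) F.a_closed word_lin_add)
  next
    fix c x assume "x \<in> carrier (hecke_algebra n q)"
    then obtain f where f: "f \<in> carrier ?F" "x = hecke_class n q f"
      by (metis hecke_class_surj)
    have "\<phi> (hecke_scalar n q c \<otimes>\<^bsub>hecke_algebra n q\<^esub> x) = word_lin g (free_scalar c \<otimes>\<^bsub>?F\<^esub> f)"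
      unfolding hecke_scalar_def f(2)
      by (metis cls f(1) free_scalar_closed hecke_class_simps(2) F.m_closed)
    also have "\<dots> = c * word_lin g f"
      by (subst word_lin_mult[OF free_scalar_closed f(1)]) simp
    finally show "\<phi> (hecke_scalar n q c \<otimes>\<^bsub>hecke_algebra n q\<^esub> x) = c * \<phi> x"
      using cls f by simp
  qed
  moreover have "\<phi> (hecke_word n q w) = g w" if "w \<in> lists {1..<n}" for w
    using cls[OF free_word_closed[OF that]] hecke_word_class[OF that] by simp
  moreover have "\<phi> \<in> extensional (carrier (hecke_algebra n q))"
    by (simp add: \<phi>_def)
  ultimately show ?thesis using that by blast
qed

section \<open>The canonical trace and the basis elements in terms of words\<close>

lemma reduced_word_SOME:
  assumes "\<sigma> permutes {1..n}"
  shows "reduced_word n \<sigma> (SOME w. reduced_word n \<sigma> w)"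
  using reduced_word_exists[OF assms] by (rule someI_ex)

text \<open>The definite description of the trace is legitimate: existence comes from the regular
  representation, and uniqueness from \<open>hecke_functional_eqI\<close>, which asks for agreement
  on a single reduced word per permutation and so fits the choice made in
  \<open>hecke_T\<close>.\<close>

lemma canonical_trace_hecke_word:
  assumes w: "w \<in> lists {1..<n}"
  shows "canonical_trace n q (hecke_word n q w) = unit_coeff q w"
proof -
  obtain \<phi> where \<phi>: "\<phi> \<in> extensional (carrier (hecke_algebra n q))" "hecke_linear_form n q \<phi>"
    "\<And>w. w \<in> lists {1..<n} \<Longrightarrow> \<phi> (hecke_word n q w) = unit_coeff q w"
    using hecke_linear_form_exists[OF hecke_functional_unit_coeff] by blast
  have \<phi>_T: "\<phi> (hecke_T n q \<sigma>) = (if \<sigma> = id then 1 else 0)" if "\<sigma> permutes {1..n}" for \<sigma>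
    unfolding hecke_T_def using reduced_word_SOME[OF that]
    by (subst \<phi>(3)) (auto dest: reduced_wordD(1) simp only: unit_coeff_reduced)
  have "canonical_trace n q = \<phi>"
    unfolding canonical_trace_def
  proof (rule the_equality)
    fix \<tau> assume \<tau>: "\<tau> \<in> extensional (carrier (hecke_algebra n q)) \<and> hecke_linear_form n q \<tau> \<and>
        (\<forall>\<sigma>. \<sigma> permutes {1..n} \<longrightarrow> \<tau> (hecke_T n q \<sigma>) = (if \<sigma> = id then 1 else 0))"
    then have lin: "hecke_linear_form n q \<tau>" by blast
    have words: "\<tau> (hecke_word n q w) = \<phi> (hecke_word n q w)" if "w \<in> lists {1..<n}" for w
    proof (rule hecke_functional_eqI[OF hecke_linear_form_functional[OF lin]
          hecke_linear_form_functional[OF \<phi>(2)] _ that])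
      fix \<sigma> assume \<sigma>: "\<sigma> permutes {1..n}"
      have "\<tau> (hecke_T n q \<sigma>) = \<phi> (hecke_T n q \<sigma>)" using \<tau> \<phi>_T \<sigma> by metis
      then show "\<exists>w. reduced_word n \<sigma> w \<and> \<tau> (hecke_word n q w) = \<phi> (hecke_word n q w)"
        unfolding hecke_T_def using reduced_word_SOME[OF \<sigma>] by blast
    qed
    show "\<tau> = \<phi>"
    proof (rule extensionalityI)
      fix x assume "x \<in> carrier (hecke_algebra n q)"
      then obtain f where f: "f \<in> carrier (free_algebra {1..<n})" "x = hecke_class n q f"
        by (metis hecke_class_surj)
      show "\<tau> x = \<phi> x"
        unfolding f(2) hecke_linear_form_class[OF lin f(1)] hecke_linear_form_class[OF \<phi>(2) f(1)]
        using words by (rule word_lin_cong[OF f(1)])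
    qed (use \<tau> \<phi> in blast)+
  qed (use \<phi> \<phi>_T in blast)
  then show ?thesis using \<phi>(3)[OF w] by simp
qed

lemma hecke_linear_form_T:
  assumes "hecke_linear_form n q \<phi>" "reduced_word n \<sigma> w"
  shows "\<phi> (hecke_T n q \<sigma>) = \<phi> (hecke_word n q w)"
  unfolding hecke_T_def
  by (rule hecke_functional_reduced_word_unique[OF hecke_linear_form_functional[OF assms(1)]
        someI[of "reduced_word n \<sigma>", OF assms(2)] assms(2)])

lemma canonical_trace_hecke_T:
  assumes "\<sigma> permutes {1..n}"
  shows "canonical_trace n q (hecke_T n q \<sigma>) = (if \<sigma> = id then 1 else 0)"
  using reduced_word_SOME[OF assms] unfolding hecke_T_def
  by (simp only: canonical_trace_hecke_word reduced_wordD(1) unit_coeff_reduced)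

section \<open>Unitarity of the representations\<close>

definition mat_trace :: "'a :: comm_ring_1 mat \<Rightarrow> 'a" where
  "mat_trace A = (\<Sum>i<dim_row A. A $$ (i, i))"

definition adj :: "complex mat \<Rightarrow> complex mat" where
  "adj A = mat (dim_col A) (dim_row A) (\<lambda>(i, j). cnj (A $$ (j, i)))"

lemma mat_mult_index:
  assumes "A \<in> carrier_mat m k" "B \<in> carrier_mat k n" "i < m" "j < n"
  shows "(A * B) $$ (i, j) = (\<Sum>l<k. A $$ (i, l) * B $$ (l, j))"
  using assms by (simp add: scalar_prod_def lessThan_atLeast0)

lemma mat_trace_comm:
  assumes "A \<in> carrier_mat m n" "B \<in> carrier_mat n m"
  shows "mat_trace (A * B) = mat_trace (B * A)"
proof -
  have "mat_trace (A * B) = (\<Sum>i<m. \<Sum>l<n. A $$ (i, l) * B $$ (l, i))"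
    using assms by (simp add: mat_trace_def mat_mult_index del: index_mult_mat(1))
  also have "\<dots> = (\<Sum>l<n. \<Sum>i<m. B $$ (l, i) * A $$ (i, l))"
    by (subst sum.swap) (simp add: mult.commute)
  also have "\<dots> = mat_trace (B * A)"
    using assms by (simp add: mat_trace_def mat_mult_index del: index_mult_mat(1))
  finally show ?thesis .
qed

lemma adj_dim [simp]: "dim_row (adj A) = dim_col A" "dim_col (adj A) = dim_row A"
  by (simp_all add: adj_def)

lemma adj_carrier [simp]: "A \<in> carrier_mat m n \<Longrightarrow> adj A \<in> carrier_mat n m"
  by (auto simp: adj_def)

lemma adj_index: "A \<in> carrier_mat m n \<Longrightarrow> i < n \<Longrightarrow> j < m \<Longrightarrow> adj A $$ (i, j) = cnj (A $$ (j, i))"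
  by (auto simp: adj_def)

lemma adj_adj [simp]: "adj (adj A) = A"
  by (rule eq_matI) (auto simp: adj_def)

lemma adj_one [simp]: "adj (1\<^sub>m n) = 1\<^sub>m n"
  by (rule eq_matI) (auto simp: adj_def)

lemma adj_mult:
  assumes "A \<in> carrier_mat m k" "B \<in> carrier_mat k n"
  shows "adj (A * B) = adj B * adj A"
proof (rule eq_matI)
  fix i j assume "i < dim_row (adj B * adj A)" "j < dim_col (adj B * adj A)"
  then have ij: "i < n" "j < m" using assms by (auto simp: adj_def)
  have "adj (A * B) $$ (i, j) = cnj (\<Sum>l<k. A $$ (j, l) * B $$ (l, i))"
    using assms ij by (simp add: adj_index[where m = m and n = n] mat_mult_index[where n = n] del: index_mult_mat(1))
  also have "\<dots> = (\<Sum>l<k. adj B $$ (i, l) * adj A $$ (l, j))"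
    using assms ij by (simp add: adj_index mult.commute)
  also have "\<dots> = (adj B * adj A) $$ (i, j)"
    using assms ij by (intro mat_mult_index[symmetric]) auto
  finally show "adj (A * B) $$ (i, j) = (adj B * adj A) $$ (i, j)" .
qed (use assms in \<open>auto simp: adj_def\<close>)

text \<open>The Hilbert-Schmidt inner product in coordinates, ready for the Cauchy-Schwarz
  inequality.\<close>

lemma mat_trace_adj_mult:
  assumes "A \<in> carrier_mat m n" "B \<in> carrier_mat m n"
  shows "mat_trace (adj A * B) = (\<Sum>(r, s) \<in> {..<m} \<times> {..<n}. cnj (A $$ (r, s)) * B $$ (r, s))"
proof -
  have "mat_trace (adj A * B) = (\<Sum>s<n. \<Sum>r<m. cnj (A $$ (r, s)) * B $$ (r, s))"
    using assms by (simp add: mat_trace_def mat_mult_index[OF adj_carrier, of A m n] adj_index[of A m n] del: index_mult_mat(1))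
  then show ?thesis
    by (subst (asm) sum.swap) (simp add: sum.cartesian_product)
qed

text \<open>The Gram matrix is positive definite: if it kills v, then the squared norm of Z v, which
  is the pairing of v with \<open>(adj Z * Z) *\<^sub>v v\<close>, is 0, and injectivity gives v =
  0.\<close>

lemma gram_mat_inverse:
  assumes Z: "Z \<in> carrier_mat m d"
    and inj: "\<And>v. v \<in> carrier_vec d \<Longrightarrow> Z *\<^sub>v v = 0\<^sub>v m \<Longrightarrow> v = 0\<^sub>v d"
  obtains P' where "P' \<in> carrier_mat d d" "(adj Z * Z) * P' = 1\<^sub>m d" "P' * (adj Z * Z) = 1\<^sub>m d" "adj P' = P'"
proof -
  let ?P = "adj Z * Z"
  have P: "?P \<in> carrier_mat d d" by (rule mult_carrier_mat[OF adj_carrier[OF Z] Z])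
  have "det ?P \<noteq> 0"
  proof
    assume "det ?P = 0"
    then obtain v where v: "v \<in> carrier_vec d" "v \<noteq> 0\<^sub>v d" "?P *\<^sub>v v = 0\<^sub>v d"
      using det_0_iff_vec_prod_zero_field[OF P] by blast
    define z where "z = Z *\<^sub>v v"
    have zc: "z \<in> carrier_vec m" using Z v by (simp add: z_def)
    have az: "adj Z *\<^sub>v z = 0\<^sub>v d"
      using v(3) Z v(1) by (simp add: z_def assoc_mult_mat_vec[OF adj_carrier[OF Z] Z v(1)])
    have "(\<Sum>r<m. cnj (z $ r) * z $ r) = (\<Sum>r<m. \<Sum>a<d. cnj (v $ a) * (cnj (Z $$ (r, a)) * z $ r))"
    proof (rule sum.cong[OF refl])
      fix r assume "r \<in> {..<m}"
      then have "z $ r = (\<Sum>a<d. Z $$ (r, a) * v $ a)"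
        using Z v(1) by (simp add: z_def scalar_prod_def lessThan_atLeast0)
      then have "cnj (z $ r) = (\<Sum>a<d. cnj (v $ a) * cnj (Z $$ (r, a)))"
        by (simp add: mult.commute)
      then show "cnj (z $ r) * z $ r = (\<Sum>a<d. cnj (v $ a) * (cnj (Z $$ (r, a)) * z $ r))"
        by (simp add: sum_distrib_right mult.assoc)
    qed
    also have "\<dots> = (\<Sum>a<d. cnj (v $ a) * (\<Sum>r<m. cnj (Z $$ (r, a)) * z $ r))"
      by (subst sum.swap) (simp add: sum_distrib_left)
    also have "\<dots> = (\<Sum>a<d. cnj (v $ a) * (adj Z *\<^sub>v z) $ a)"
      using Z zc by (intro sum.cong refl) (simp add: scalar_prod_def lessThan_atLeast0 adj_def)
    also have "\<dots> = 0" by (simp add: az)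
    finally have "(\<Sum>r<m. cnj (z $ r) * z $ r) = 0" .
    then have "complex_of_real (\<Sum>r<m. (cmod (z $ r))\<^sup>2) = 0"
      unfolding of_real_sum complex_norm_square by (simp only: mult.commute)
    then have "(\<Sum>r<m. (cmod (z $ r))\<^sup>2) = 0" by (simp only: of_real_eq_0_iff)
    then have "\<forall>r<m. z $ r = 0"
      by (subst (asm) sum_nonneg_eq_0_iff) auto
    then have "z = 0\<^sub>v m" using zc by (intro eq_vecI) auto
    then show False using inj[OF v(1)] v(2) by (simp add: z_def)
  qed
  from det_non_zero_imp_unit[OF P this, of "()"] obtain P' where
    P': "P' \<in> carrier_mat d d" "P' * ?P = 1\<^sub>m d" "?P * P' = 1\<^sub>m d"
    by (auto simp: Units_def ring_mat_simps)
  have P_adj: "adj ?P = ?P" using adj_mult[OF adj_carrier[OF Z] Z] by simp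
  \<comment> \<open>Taking adjoints in \<open>?P * P' = 1\<close> shows that \<open>adj P'\<close>
    is a left inverse too, hence equal to P'.\<close>
  have "adj P' * ?P = 1\<^sub>m d"
    using adj_mult[OF P P'(1)] unfolding P'(3) P_adj by simp
  then have "adj P' * ?P * P' = P'" using P' by simp
  moreover have "adj P' * ?P * P' = adj P' * (?P * P')"
    using P P' by (intro assoc_mult_mat) auto
  ultimately have "adj P' = P'" using P' by (simp add: right_mult_one_mat[OF adj_carrier[OF P'(1)]])
  with P' show ?thesis using that by blast
qed

section \<open>Matrices of words in a representation\<close>

lemma hecke_word_closed: "w \<in> lists {1..<n} \<Longrightarrow> hecke_word n q w \<in> carrier (hecke_algebra n q)"
  by (simp only: hecke_word_class hecke_class_simps(1) free_word_closed)

lemma hecke_gen_closed: "i \<in> {1..<n} \<Longrightarrow> hecke_gen n q i \<in> carrier (hecke_algebra n q)"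
  unfolding hecke_gen_def by (intro hecke_class_simps(1) free_gen_closed)

lemma hecke_word_append:
  assumes "u \<in> lists {1..<n}" "v \<in> lists {1..<n}"
  shows "hecke_word n q (u @ v) = hecke_word n q u \<otimes>\<^bsub>hecke_algebra n q\<^esub> hecke_word n q v"
proof -
  interpret ring "hecke_algebra n q" by (rule hecke_algebra_ring)
  have step: "hecke_word n q (i # w) = hecke_gen n q i \<otimes>\<^bsub>hecke_algebra n q\<^esub> hecke_word n q w" for i w
    by (simp add: hecke_word_def)
  show ?thesis
    using assms(1)
  proof induction
    case Nil
    then show ?case using hecke_word_closed[OF assms(2)] by (simp add: hecke_word_def[of _ _ "[]"])
  next
    case (Cons i w)
    then show ?case
      using m_assoc[OF hecke_gen_closed[OF Cons.hyps(1)] hecke_word_closed[OF Cons.hyps(2)] hecke_word_closed[OF assms(2)]]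
      by (simp only: append_Cons step)
  qed
qed

locale hecke_representation =
  fixes n :: nat and q :: real and d :: nat and \<rho> :: "(nat list \<Rightarrow> complex) set \<Rightarrow> complex mat"
  assumes rep: "hecke_rep n q d \<rho>" and q_pos: "q > 0"
begin

definition R :: "nat list \<Rightarrow> complex mat" where
  "R w = \<rho> (hecke_word n q w)"

lemma rho_hom: "\<rho> \<in> Ring.ring_hom (hecke_algebra n q) (ring_mat TYPE(complex) d ())"
  using rep by (simp add: hecke_rep_def)

lemma rho_carrier: "x \<in> carrier (hecke_algebra n q) \<Longrightarrow> \<rho> x \<in> carrier_mat d d"
  using Ring.ring_hom_closed[OF rho_hom] by (simp add: ring_mat_simps)

lemma R_carrier: "w \<in> lists {1..<n} \<Longrightarrow> R w \<in> carrier_mat d d"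
  unfolding R_def by (intro rho_carrier hecke_word_closed)

lemma R_append: "u \<in> lists {1..<n} \<Longrightarrow> v \<in> lists {1..<n} \<Longrightarrow> R (u @ v) = R u * R v"
  using Ring.ring_hom_mult[OF rho_hom hecke_word_closed hecke_word_closed]
  unfolding R_def by (simp only: hecke_word_append ring_mat_simps)

lemma R_Nil: "R [] = 1\<^sub>m d"
  using Ring.ring_hom_one[OF rho_hom] by (simp add: R_def hecke_word_def ring_mat_simps)

lemma linear_form_entry:
  assumes "a < d" "b < d"
  shows "hecke_linear_form n q (\<lambda>x. \<rho> x $$ (a, b))"
  unfolding hecke_linear_form_def
proof (intro conjI ballI allI)
  fix x y assume xy: "x \<in> carrier (hecke_algebra n q)" "y \<in> carrier (hecke_algebra n q)"
  show "\<rho> (x \<oplus>\<^bsub>hecke_algebra n q\<^esub> y) $$ (a, b) = \<rho> x $$ (a, b) + \<rho> y $$ (a, b)"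
    using Ring.ring_hom_add[OF rho_hom xy] assms rho_carrier[OF xy(2)] by (simp add: ring_mat_simps)
next
  fix c x assume x: "x \<in> carrier (hecke_algebra n q)"
  have s: "hecke_scalar n q c \<in> carrier (hecke_algebra n q)"
    unfolding hecke_scalar_def by (intro hecke_class_simps(1) free_scalar_closed)
  have "\<rho> (hecke_scalar n q c \<otimes>\<^bsub>hecke_algebra n q\<^esub> x) = (c \<cdot>\<^sub>m 1\<^sub>m d) * \<rho> x"
    using Ring.ring_hom_mult[OF rho_hom s x] rep by (simp add: ring_mat_simps hecke_rep_def)
  also have "\<dots> = c \<cdot>\<^sub>m \<rho> x"
    using rho_carrier[OF x] by (simp add: mult_smult_assoc_mat[of _ d d])
  finally show "\<rho> (hecke_scalar n q c \<otimes>\<^bsub>hecke_algebra n q\<^esub> x) $$ (a, b) = c * \<rho> x $$ (a, b)"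
    using rho_carrier[OF x] assms by simp
qed

lemma functional_entry:
  assumes "a < d" "b < d"
  shows "hecke_functional n q (\<lambda>w. R w $$ (a, b))"
  unfolding R_def by (rule hecke_linear_form_functional[OF linear_form_entry[OF assms]])

lemma linear_form_character: "hecke_linear_form n q (normalized_character d \<rho>)"
  unfolding hecke_linear_form_def
proof (intro conjI ballI allI)
  fix x y assume xy: "x \<in> carrier (hecke_algebra n q)" "y \<in> carrier (hecke_algebra n q)"
  show "normalized_character d \<rho> (x \<oplus>\<^bsub>hecke_algebra n q\<^esub> y) = normalized_character d \<rho> x + normalized_character d \<rho> y"
    unfolding normalized_character_def add_divide_distrib[symmetric] sum.distrib[symmetric]
    using hecke_linear_formD(1)[OF linear_form_entry xy] by simp
next
  fix c x assume x: "x \<in> carrier (hecke_algebra n q)"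
  show "normalized_character d \<rho> (hecke_scalar n q c \<otimes>\<^bsub>hecke_algebra n q\<^esub> x) = c * normalized_character d \<rho> x"
    unfolding normalized_character_def times_divide_eq_right sum_distrib_left
    using hecke_linear_formD(2)[OF linear_form_entry x] by simp
qed

lemma character_eq_trace:
  assumes "w \<in> lists {1..<n}"
  shows "normalized_character d \<rho> (hecke_word n q w) = mat_trace (R w) / of_nat d"
  using R_carrier[OF assms] by (simp add: normalized_character_def mat_trace_def R_def)

end

definition red_word :: "nat \<Rightarrow> (nat \<Rightarrow> nat) \<Rightarrow> nat list" where
  "red_word n \<sigma> = (SOME w. reduced_word n \<sigma> w)"

lemma red_word: "reduced_word n \<sigma> (red_word n \<sigma>)" if "\<sigma> permutes {1..n}"
  unfolding red_word_def by (rule reduced_word_SOME[OF that])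

lemma transpose_comp_permutes:
  assumes "\<sigma> permutes {1..n}" "i \<in> {1..<n}"
  shows "Transposition.transpose i (Suc i) \<circ> \<sigma> permutes {1..n}"
  using assms by (intro permutes_compose permutes_swap_id) auto

text \<open>Left multiplication in the standard basis: T_i T_\<sigma> is T_\<tau> if the length goes
  up, and (q - 1) T_\<sigma> + q T_\<tau> if it goes down. Quantifying over functionals makes it
  available for every matrix entry.\<close>

lemma red_word_cases:
  assumes \<sigma>: "\<sigma> permutes {1..n}" and i: "i \<in> {1..<n}"
  defines "\<tau> \<equiv> Transposition.transpose i (Suc i) \<circ> \<sigma>"
  obtains (up) "length (red_word n \<tau>) = Suc (length (red_word n \<sigma>))"
      "\<And>g. hecke_functional n q g \<Longrightarrow> g (i # red_word n \<sigma>) = g (red_word n \<tau>)"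
  | (down) "length (red_word n \<sigma>) = Suc (length (red_word n \<tau>))"
      "\<And>g. hecke_functional n q g \<Longrightarrow> g (i # red_word n \<sigma>) =
          (of_real q - 1) * g (red_word n \<sigma>) + of_real q * g (red_word n \<tau>)"
proof -
  note w = red_word[OF \<sigma>]
  note w' = red_word[OF transpose_comp_permutes[OF \<sigma> i], folded \<tau>_def]
  let ?w = "red_word n \<sigma>"
  consider "word_perm (rev ?w) i < word_perm (rev ?w) (Suc i)"
    | "word_perm (rev ?w) i > word_perm (rev ?w) (Suc i)"
    using word_perm_rev_neq[of i "Suc i" ?w] by force
  then show ?thesis
  proof cases
    case 1
    from reduced_word_ConsI[OF w i 1] have r: "reduced_word n \<tau> (i # ?w)" by (simp add: \<tau>_def)
    show ?thesis
      using reduced_word_length_eq[OF r w'] hecke_functional_reduced_word_unique[OF _ r w']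
      by (intro up) simp_all
  next
    case 2
    from reduced_word_descent[OF w i this] obtain z where z: "reduced_word n \<sigma> (i # z)" ..
    note rz = reduced_word_ConsD(2)[OF z, folded \<tau>_def]
    have zl: "z \<in> lists {1..<n}" using reduced_wordD(1)[OF rz] .
    show ?thesis
    proof (rule down)
      show "length ?w = Suc (length (red_word n \<tau>))"
        using reduced_word_length_eq[OF z w] reduced_word_length_eq[OF rz w'] by simp
      fix g assume g: "hecke_functional n q g"
      have gi: "hecke_functional n q (\<lambda>x. g ([i] @ x))"
        using i by (intro hecke_functional_append[OF g]) simp
      have "g (i # ?w) = g (i # i # z)"
        using hecke_functional_reduced_word_unique[OF gi w z] by simp
      also have "\<dots> = (of_real q - 1) * g (i # z) + of_real q * g z"
        using hecke_functionalD(1)[OF g lists.Nil zl i] by simp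
      also have "g (i # z) = g ?w" by (rule hecke_functional_reduced_word_unique[OF g z w])
      also have "g z = g (red_word n \<tau>)" by (rule hecke_functional_reduced_word_unique[OF g rz w'])
      finally show "g (i # ?w) = (of_real q - 1) * g ?w + of_real q * g (red_word n \<tau>)" .
    qed
  qed
qed

text \<open>The Coxeter element c = s_1 ... s_(n-1) satisfies c s_i = s_(i+1) c by braid and
  commutation relations alone: the last letter i moves left past the letters above i+1, a braid move
  turns i, i+1, i into i+1, i, i+1, and the leading i+1 moves left past the letters below i.\<close>

lemma hecke_functional_shift_gen:
  assumes g: "hecke_functional n q g" and i: "1 \<le> i" "Suc i < n"
  shows "g ([1..<n] @ [i]) = g (Suc i # [1..<n])"
proof -
  note D = hecke_functionalD[OF g]
  have right: "g (u @ ys @ [i]) = g (u @ i # ys)"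
    if "u \<in> lists {1..<n}" "ys \<in> lists {1..<n}" "\<forall>y \<in> set ys. Suc i < y" for u ys
    using that
  proof (induction ys arbitrary: u)
    case (Cons y ys)
    have "g (u @ (y # ys) @ [i]) = g ((u @ [y]) @ i # ys)"
      using Cons.IH[of "u @ [y]"] Cons.prems by simp
    also have "\<dots> = g (u @ i # y # ys)"
      using D(3)[of u ys i y] Cons.prems i by simp
    finally show ?case .
  qed simp
  have left: "g (ys @ Suc i # v) = g (Suc i # ys @ v)"
    if "v \<in> lists {1..<n}" "ys \<in> lists {1..<n}" "\<forall>y \<in> set ys. y < i" for v ys
    using that
  proof (induction ys arbitrary: v rule: rev_induct)
    case (snoc y ys)
    have "g ((ys @ [y]) @ Suc i # v) = g (ys @ Suc i # y # v)"
      using D(3)[of ys v y "Suc i"] snoc.prems i by simp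
    also have "\<dots> = g (Suc i # ys @ y # v)"
      using snoc.IH[of "y # v"] snoc.prems by simp
    finally show ?case by simp
  qed simp
  let ?a = "[1..<i]" and ?b = "[Suc (Suc i)..<n]"
  have c: "[1..<n] = ?a @ i # Suc i # ?b"
    using i upt_add_eq_append[of 1 i "n - i"] by (simp add: upt_conv_Cons)
  have "g ([1..<n] @ [i]) = g ((?a @ [i, Suc i]) @ ?b @ [i])" by (simp only: c append_assoc append_Cons append_Nil)
  also have "\<dots> = g (?a @ i # Suc i # i # ?b)"
    using i by (subst right) auto
  also have "\<dots> = g (?a @ Suc i # i # Suc i # ?b)"
    using i by (intro D(2)) auto
  also have "\<dots> = g (Suc i # ?a @ i # Suc i # ?b)"
    using i by (intro left) auto
  finally show ?thesis by (simp only: c)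
qed

section \<open>Invertibility of the letters, conjugate translates, invariant inner product\<close>

context hecke_representation
begin

lemma R_eqI:
  assumes "u \<in> lists {1..<n}" "v \<in> lists {1..<n}"
    and "\<And>g. hecke_functional n q g \<Longrightarrow> g u = g v"
  shows "R u = R v"
  using R_carrier[OF assms(1)] R_carrier[OF assms(2)] assms(3)[OF functional_entry]
  by (intro eq_matI) auto

lemma R_Cons:
  assumes "i \<in> {1..<n}" "w \<in> lists {1..<n}"
  shows "R (i # w) = R [i] * R w"
  using R_append[of "[i]" w] assms by simp

text \<open>The quadratic relation arranged so as to display the inverse of a letter, (T_i - (q -
  1)) / q.\<close>

lemma R_quadratic:
  assumes i: "i \<in> {1..<n}"
  shows "R [i] * (R [i] - (of_real q - 1) \<cdot>\<^sub>m 1\<^sub>m d) = of_real q \<cdot>\<^sub>m 1\<^sub>m d"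
proof -
  have l: "[i] \<in> lists {1..<n}" using i by simp
  note Rc = R_carrier[OF l]
  have "R [i] * (R [i] - (of_real q - 1) \<cdot>\<^sub>m 1\<^sub>m d) = R [i] * R [i] - (of_real q - 1) \<cdot>\<^sub>m R [i]"
    using Rc by (simp add: mult_minus_distrib_mat[of _ d d _ d] mult_smult_distrib[of _ d d _ d])
  also have "R [i] * R [i] = R [i, i]" using R_Cons[OF i l] by simp
  also have "R [i, i] - (of_real q - 1) \<cdot>\<^sub>m R [i] = of_real q \<cdot>\<^sub>m 1\<^sub>m d"
  proof (rule eq_matI)
    fix a b assume "a < dim_row (of_real q \<cdot>\<^sub>m 1\<^sub>m d :: complex mat)" "b < dim_col (of_real q \<cdot>\<^sub>m 1\<^sub>m d :: complex mat)"
    then have ab: "a < d" "b < d" by auto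
    have "R [i, i] $$ (a, b) = (of_real q - 1) * R [i] $$ (a, b) + of_real q * R [] $$ (a, b)"
      using hecke_functionalD(1)[OF functional_entry[OF ab] lists.Nil lists.Nil i] by simp
    then show "(R [i, i] - (of_real q - 1) \<cdot>\<^sub>m R [i]) $$ (a, b) = (of_real q \<cdot>\<^sub>m 1\<^sub>m d) $$ (a, b)"
      using ab Rc by (simp add: R_Nil)
  qed (use Rc in auto)
  finally show ?thesis .
qed

lemma R_invertible:
  assumes "w \<in> lists {1..<n}"
  shows "\<exists>D \<in> carrier_mat d d. R w * D = 1\<^sub>m d \<and> D * R w = 1\<^sub>m d"
proof -
  have "\<exists>D \<in> carrier_mat d d. R w * D = 1\<^sub>m d"
    using assms
  proof induction
    case Nil
    then show ?case by (intro bexI[of _ "1\<^sub>m d"]) (auto simp: R_Nil)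
  next
    case (Cons i w)
    then obtain D where D: "D \<in> carrier_mat d d" "R w * D = 1\<^sub>m d" by blast
    have l: "[i] \<in> lists {1..<n}" using Cons.hyps by simp
    note Ri = R_carrier[OF l] and Rw = R_carrier[OF Cons.hyps(2)]
    let ?E = "(1 / of_real q) \<cdot>\<^sub>m (R [i] - (of_real q - 1) \<cdot>\<^sub>m 1\<^sub>m d)"
    have E: "?E \<in> carrier_mat d d" by (rule carrier_matI) simp_all
    have "R [i] * ?E = 1\<^sub>m d"
      using Ri q_pos by (subst mult_smult_distrib[of _ d d _ d])
        (auto simp: R_quadratic[OF Cons.hyps(1)] intro!: eq_matI)
    moreover have "R (i # w) * (D * ?E) = R [i] * (R w * (D * ?E))"
      unfolding R_Cons[OF Cons.hyps] using Ri Rw D(1) E by (intro assoc_mult_mat) auto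
    moreover have "R w * (D * ?E) = R w * D * ?E"
      using Rw D(1) E by (intro assoc_mult_mat[symmetric])
    ultimately have "R (i # w) * (D * ?E) = 1\<^sub>m d"
      unfolding D(2) left_mult_one_mat[OF E] by (simp only:)
    then show ?case using D E by (intro bexI[of _ "D * ?E"]) auto
  qed
  then obtain D where "D \<in> carrier_mat d d" "R w * D = 1\<^sub>m d" by blast
  then show ?thesis
    using mat_mult_left_right_inverse[OF R_carrier[OF assms]] by blast
qed

text \<open>Pushing the matrix of \<open>[1..<n]\<close> through w letter by letter raises every
  letter by one; that matrix is invertible and the trace is invariant under conjugation.\<close>

lemma trace_shift_Suc:
  assumes w: "w \<in> lists {1..<n}" "map Suc w \<in> lists {1..<n}"
  shows "mat_trace (R (map Suc w)) = mat_trace (R w)"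
proof -
  let ?c = "[1..<n]"
  have cl: "?c \<in> lists {1..<n}" by auto
  note C = R_carrier[OF cl]
  have conj: "R ?c * R w = R (map Suc w) * R ?c"
    using w
  proof (induction w)
    case Nil
    then show ?case using C by (simp add: R_Nil)
  next
    case (Cons i w)
    have i: "i \<in> {1..<n}" "Suc i \<in> {1..<n}" and wl: "w \<in> lists {1..<n}" "map Suc w \<in> lists {1..<n}"
      using Cons by auto
    have il: "[i] \<in> lists {1..<n}" "[Suc i] \<in> lists {1..<n}" using i by auto
    note Rs = R_carrier[OF il(1)] R_carrier[OF il(2)] R_carrier[OF wl(1)] R_carrier[OF wl(2)]
    have step: "R ?c * R [i] = R [Suc i] * R ?c"
    proof -
      have "R (?c @ [i]) = R (Suc i # ?c)"
        using i il cl by (intro R_eqI hecke_functional_shift_gen) auto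
      then show ?thesis using R_append[OF cl il(1)] R_Cons[OF i(2) cl] by simp
    qed
    have "R ?c * R (i # w) = R ?c * R [i] * R w"
      using C Rs unfolding R_Cons[OF i(1) wl(1)] by (simp add: assoc_mult_mat[of _ d d _ d _ d])
    also have "\<dots> = R [Suc i] * (R ?c * R w)"
      unfolding step using C Rs by (simp add: assoc_mult_mat[of _ d d _ d _ d])
    also have "R ?c * R w = R (map Suc w) * R ?c" using Cons wl by blast
    also have "R [Suc i] * (R (map Suc w) * R ?c) = R (map Suc (i # w)) * R ?c"
      using C Rs R_Cons[OF i(2) wl(2)] by (simp add: assoc_mult_mat[of _ d d _ d _ d])
    finally show ?case .
  qed
  obtain D where D: "D \<in> carrier_mat d d" "R ?c * D = 1\<^sub>m d" "D * R ?c = 1\<^sub>m d"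
    using R_invertible[OF cl] by blast
  note Rw = R_carrier[OF w(1)] R_carrier[OF w(2)]
  have "R (map Suc w) = R (map Suc w) * (R ?c * D)" using D Rw by simp
  also have "\<dots> = R ?c * R w * D"
    unfolding conj using D Rw C by (intro assoc_mult_mat[symmetric]) auto
  also have "mat_trace \<dots> = mat_trace (D * (R ?c * R w))"
    by (rule mat_trace_comm[OF mult_carrier_mat[OF C Rw(1)] D(1)])
  also have "D * (R ?c * R w) = R w"
    using D Rw C by (simp add: assoc_mult_mat[of D d d, symmetric])
  finally show ?thesis .
qed

lemma trace_shift:
  assumes "\<forall>i \<in> set w. 1 \<le> i \<and> i + m < n"
  shows "mat_trace (R (map (\<lambda>i. i + m) w)) = mat_trace (R w)"
  using assms
proof (induction m)
  case (Suc m)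
  have "mat_trace (R (map Suc (map (\<lambda>i. i + m) w))) = mat_trace (R (map (\<lambda>i. i + m) w))"
    using Suc.prems by (intro trace_shift_Suc) force+
  moreover have "mat_trace (R (map (\<lambda>i. i + m) w)) = mat_trace (R w)"
    using Suc.prems by (intro Suc.IH) auto
  ultimately show ?case by (simp add: comp_def)
qed simp

text \<open>The matrix of the basis element of the inverse of \<sigma>. After reversal, multiplying
  on the right by T_i means prefixing i to \<open>red_word n \<sigma>\<close>, the situation of
  \<open>red_word_cases\<close>.\<close>

definition X :: "(nat \<Rightarrow> nat) \<Rightarrow> complex mat" where
  "X \<sigma> = R (rev (red_word n \<sigma>))"

lemma red_word_lists: "\<sigma> permutes {1..n} \<Longrightarrow> rev (red_word n \<sigma>) \<in> lists {1..<n}"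
  using reduced_wordD(1)[OF red_word[of \<sigma> n]] unfolding lists_eq_set by simp

lemma X_carrier: "\<sigma> permutes {1..n} \<Longrightarrow> X \<sigma> \<in> carrier_mat d d"
  unfolding X_def by (intro R_carrier red_word_lists)

lemma X_id: "X id = 1\<^sub>m d"
proof -
  have "red_word n id = []"
    using reduced_word_length_eq[OF red_word[OF permutes_id] reduced_word_Nil] by simp
  then show ?thesis by (simp add: X_def R_Nil del: id_apply)
qed

text \<open>
  The matrix \<open>\<Sum>\<^sub>\<sigma> q^(- length \<sigma>) X\<^sub>\<sigma>\<^sup>* X\<^sub>\<sigma>\<close> defines an inner product for which all \<open>T\<^sub>i\<close> are self-adjoint:
  pairing \<open>\<sigma>\<close> with \<open>s\<^sub>i \<sigma>\<close> makes its product with \<open>T\<^sub>i\<close> Hermitian.  The rows of \<open>Z\<close> are those of the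
  matrices \<open>q^(- length \<sigma> / 2) X\<^sub>\<sigma>\<close>, so this inner product is \<open>Z\<^sup>* Z\<close>.
\<close>

lemma unitarizing_matrix:
  obtains m Z where "Z \<in> carrier_mat m d"
    "\<And>v. v \<in> carrier_vec d \<Longrightarrow> Z *\<^sub>v v = 0\<^sub>v m \<Longrightarrow> v = 0\<^sub>v d"
    "\<And>i. i \<in> {1..<n} \<Longrightarrow> (adj Z * Z) * R [i] = adj (R [i]) * (adj Z * Z)"
proof -
  define S where "S = {\<sigma>. \<sigma> permutes {1..n}}"
  define I where "I = S \<times> {..<d}"
  have "finite I" by (simp add: I_def S_def finite_permutations)
  \<comment> \<open>A row of Z is indexed by a permutation together with a row of its matrix; h
    numbers these pairs.\<close>
  then obtain h where h: "bij_betw h {..<card I} I"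
    using ex_bij_betw_nat_finite[of I] by (auto simp: lessThan_atLeast0)
  define len where "len \<sigma> = length (red_word n \<sigma>)" for \<sigma>
  define y where "y \<sigma> = complex_of_real (sqrt (1 / q) ^ len \<sigma>)" for \<sigma>
  define Z where "Z = mat (card I) d (\<lambda>(r, a). y (fst (h r)) * X (fst (h r)) $$ (snd (h r), a))"
  have Zc: "Z \<in> carrier_mat (card I) d" by (simp add: Z_def)
  have hI: "h r \<in> I" if "r < card I" for r using h that by (auto simp: bij_betw_def)
  have hS: "fst (h r) permutes {1..n}" "snd (h r) < d" if "r < card I" for r
    using hI[OF that] by (auto simp: I_def S_def)
  have y2: "cnj (y \<sigma>) * y \<sigma> = (1 / of_real q) ^ len \<sigma>" for \<sigma>
  proof -
    have "sqrt (1 / q) ^ len \<sigma> * sqrt (1 / q) ^ len \<sigma> = (1 / q) ^ len \<sigma>"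
      using q_pos by (simp flip: power_mult_distrib)
    then show ?thesis unfolding y_def complex_cnj_complex_of_real of_real_mult[symmetric] by simp
  qed
  \<comment> \<open>The rows belonging to \<sigma> = id form a nonzero multiple of the identity
    matrix, since \<open>X id\<close> is the identity.\<close>
  have inj: "v = 0\<^sub>v d" if v: "v \<in> carrier_vec d" "Z *\<^sub>v v = 0\<^sub>v (card I)" for v
  proof (rule eq_vecI)
    fix k assume "k < dim_vec (0\<^sub>v d :: complex vec)"
    then have k: "k < d" by simp
    have "(id, k) \<in> I" using k by (simp add: I_def S_def permutes_id del: id_apply)
    then have "(id, k) \<in> h ` {..<card I}" using bij_betw_imp_surj_on[OF h] by simp
    then obtain r where "(id, k) = h r" "r \<in> {..<card I}" by (rule imageE)
    then have r: "r < card I" "h r = (id, k)" by simp_all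
    have "(Z *\<^sub>v v) $ r = (\<Sum>a<d. y id * (1\<^sub>m d $$ (k, a)) * v $ a)"
      using r v(1) by (simp add: Z_def scalar_prod_def lessThan_atLeast0 X_id del: id_apply index_one_mat)
    also have "\<dots> = (\<Sum>a\<in>{k}. y id * v $ a)"
      using k by (intro sum.mono_neutral_cong_right) auto
    finally have "y id * v $ k = 0" using v(2) r by simp
    moreover have "y id \<noteq> 0" using q_pos by (simp add: y_def)
    ultimately show "v $ k = 0\<^sub>v d $ k" using k by simp
  qed (use v in simp)
  have "(adj Z * Z) * R [i] = adj (R [i]) * (adj Z * Z)" if i: "i \<in> {1..<n}" for i
  proof -
    have il: "[i] \<in> lists {1..<n}" using i by simp
    note Ri = R_carrier[OF il]
    let ?s = "\<lambda>\<sigma>. Transposition.transpose i (Suc i) \<circ> \<sigma>"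
    \<comment> \<open>The weight is chosen to make the coefficient between \<sigma> and its partner
      symmetric. An upward step has coefficient 1 and gives q^(- len \<sigma>), a downward step has
      coefficient q and gives q^(1 - len \<sigma>); in both cases the exponent is minus the smaller
      length.\<close>
    define \<kappa> :: "(nat \<Rightarrow> nat) \<Rightarrow> complex" where "\<kappa> \<sigma> = (1 / of_real q) ^ min (len \<sigma>) (len (?s \<sigma>))" for \<sigma>
    define \<delta> :: "(nat \<Rightarrow> nat) \<Rightarrow> complex" where
      "\<delta> \<sigma> = (if len (?s \<sigma>) < len \<sigma> then (of_real q - 1) * (1 / of_real q) ^ len \<sigma> else 0)" for \<sigma>
    have \<kappa>_s: "\<kappa> (?s \<sigma>) = \<kappa> \<sigma>" for \<sigma> by (simp add: \<kappa>_def min.commute)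
    have \<kappa>\<delta>_real: "cnj (\<kappa> \<sigma>) = \<kappa> \<sigma>" "cnj (\<delta> \<sigma>) = \<delta> \<sigma>" for \<sigma> by (auto simp: \<kappa>_def \<delta>_def)
    have XR: "(1 / of_real q) ^ len \<sigma> * (X \<sigma> * R [i]) $$ (k, b) =
        \<delta> \<sigma> * X \<sigma> $$ (k, b) + \<kappa> \<sigma> * X (?s \<sigma>) $$ (k, b)"
      if \<sigma>: "\<sigma> permutes {1..n}" and kb: "k < d" "b < d" for \<sigma> k b
    proof -
      note g = hecke_functional_rev[OF functional_entry[OF kb]]
      have X: "X \<sigma> * R [i] = R (rev (i # red_word n \<sigma>))"
        using R_append[OF red_word_lists[OF \<sigma>] il] by (simp add: X_def)
      show ?thesis
      proof (rule red_word_cases[OF \<sigma> i])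
        assume up: "length (red_word n (?s \<sigma>)) = Suc (length (red_word n \<sigma>))"
          "\<And>g. hecke_functional n q g \<Longrightarrow> g (i # red_word n \<sigma>) = g (red_word n (?s \<sigma>))"
        have "(X \<sigma> * R [i]) $$ (k, b) = X (?s \<sigma>) $$ (k, b)"
          using up(2)[OF g] unfolding X by (simp only: X_def)
        moreover have "len (?s \<sigma>) = Suc (len \<sigma>)" using up(1) by (simp add: len_def)
        ultimately show ?thesis by (simp add: \<kappa>_def \<delta>_def)
      next
        assume down: "length (red_word n \<sigma>) = Suc (length (red_word n (?s \<sigma>)))"
          "\<And>g. hecke_functional n q g \<Longrightarrow> g (i # red_word n \<sigma>) =
             (of_real q - 1) * g (red_word n \<sigma>) + of_real q * g (red_word n (?s \<sigma>))"
        have "(X \<sigma> * R [i]) $$ (k, b) = (of_real q - 1) * X \<sigma> $$ (k, b) + of_real q * X (?s \<sigma>) $$ (k, b)"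
          using down(2)[OF g] unfolding X by (simp only: X_def)
        moreover have "len \<sigma> = Suc (len (?s \<sigma>))" using down(1) by (simp add: len_def)
        ultimately show ?thesis using q_pos by (simp add: \<kappa>_def \<delta>_def field_simps)
      qed
    qed
    have ZR: "(Z * R [i]) $$ (r, b) = y (fst (h r)) * (X (fst (h r)) * R [i]) $$ (snd (h r), b)"
      if "r < card I" "b < d" for r b
      using that hS[OF that(1)] mat_mult_index[OF Zc Ri that]
        mat_mult_index[OF X_carrier[OF hS(1)[OF that(1)]] Ri hS(2)[OF that(1)] that(2)]
      by (simp add: Z_def sum_distrib_left mult.assoc)
    have sum1: "(adj Z * (Z * R [i])) $$ (a, b) =
        (\<Sum>(\<sigma>, k)\<in>I. \<delta> \<sigma> * (cnj (X \<sigma> $$ (k, a)) * X \<sigma> $$ (k, b)) +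
                     \<kappa> \<sigma> * (cnj (X \<sigma> $$ (k, a)) * X (?s \<sigma>) $$ (k, b)))" (is "_ = sum ?f I")
      if ab: "a < d" "b < d" for a b
    proof -
      have "(adj Z * (Z * R [i])) $$ (a, b) = (\<Sum>r<card I. adj Z $$ (a, r) * (Z * R [i]) $$ (r, b))"
        by (rule mat_mult_index[OF adj_carrier[OF Zc] mult_carrier_mat[OF Zc Ri] ab])
      also have "\<dots> = (\<Sum>r<card I. ?f (h r))"
      proof (rule sum.cong[OF refl])
        fix r assume "r \<in> {..<card I}"
        then have r: "r < card I" by simp
        obtain \<sigma> k where hr: "h r = (\<sigma>, k)" by fastforce
        have \<sigma>k: "\<sigma> permutes {1..n}" "k < d" using hS[OF r] hr by auto
        have "adj Z $$ (a, r) * (Z * R [i]) $$ (r, b) =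
            cnj (X \<sigma> $$ (k, a)) * ((cnj (y \<sigma>) * y \<sigma>) * (X \<sigma> * R [i]) $$ (k, b))"
          unfolding ZR[OF r ab(2)] adj_index[OF Zc ab(1) r] using r ab by (simp add: Z_def hr mult.assoc mult.left_commute)
        also have "\<dots> = ?f (h r)"
          unfolding y2 XR[OF \<sigma>k ab(2)] hr by (simp add: algebra_simps)
        finally show "adj Z $$ (a, r) * (Z * R [i]) $$ (r, b) = ?f (h r)" .
      qed
      also have "\<dots> = sum ?f I" by (rule sum.reindex_bij_betw[OF h])
      finally show ?thesis .
    qed
    have herm: "(adj Z * (Z * R [i])) $$ (a, b) = cnj ((adj Z * (Z * R [i])) $$ (b, a))" if ab: "a < d" "b < d" for a b
    proof -
      have "(\<Sum>(\<sigma>, k)\<in>I. \<kappa> \<sigma> * (cnj (X \<sigma> $$ (k, a)) * X (?s \<sigma>) $$ (k, b))) =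
          (\<Sum>(\<sigma>, k)\<in>I. \<kappa> \<sigma> * (cnj (X (?s \<sigma>) $$ (k, a)) * X \<sigma> $$ (k, b)))"
        by (rule sum.reindex_bij_witness[where i = "\<lambda>(\<sigma>, k). (?s \<sigma>, k)" and j = "\<lambda>(\<sigma>, k). (?s \<sigma>, k)"])
          (use transpose_comp_permutes[OF _ i] in \<open>auto simp: I_def S_def \<kappa>_s simp del: One_nat_def\<close>)
      then show ?thesis
        unfolding sum1[OF ab] sum1[OF ab(2,1)]
        by (simp add: case_prod_unfold sum.distrib \<kappa>\<delta>_real mult.commute mult.left_commute)
    qed
    have "adj Z * (Z * R [i]) = adj (adj Z * (Z * R [i]))"
    proof (rule eq_matI)
      fix a b assume "a < dim_row (adj (adj Z * (Z * R [i])))" "b < dim_col (adj (adj Z * (Z * R [i])))"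
      then have ab: "a < d" "b < d" using Zc Ri by auto
      show "(adj Z * (Z * R [i])) $$ (a, b) = adj (adj Z * (Z * R [i])) $$ (a, b)"
        unfolding herm[OF ab]
        by (rule adj_index[symmetric, OF mult_carrier_mat[OF adj_carrier[OF Zc] mult_carrier_mat[OF Zc Ri]] ab])
    qed (use Zc Ri in auto)
    also have "\<dots> = adj (R [i]) * adj Z * Z"
      by (simp add: adj_mult[OF adj_carrier[OF Zc] mult_carrier_mat[OF Zc Ri]] adj_mult[OF Zc Ri])
    finally show ?thesis
      using Zc Ri by (simp add: assoc_mult_mat[of _ d "card I" _ d _ d] assoc_mult_mat[of _ d d _ "card I" _ d])
  qed
  with Zc inj show ?thesis by (rule that)
qed

text \<open>With respect to the inner product of P = \<open>adj Z * Z\<close>, the adjoint of the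
  matrix of u is the matrix of \<open>rev u\<close>. Hence the trace on the left is a positive
  semidefinite kernel in u and v, and the vectors \<zeta> u exhibit it as a Gram kernel.\<close>

lemma trace_gram:
  obtains J :: "(nat \<times> nat) set" and \<zeta> where "finite J"
    "\<And>u v. u \<in> lists {1..<n} \<Longrightarrow> v \<in> lists {1..<n} \<Longrightarrow>
       mat_trace (R (rev u @ v)) = (\<Sum>x\<in>J. cnj (\<zeta> u x) * \<zeta> v x)"
proof -
  obtain Z m where Z: "Z \<in> carrier_mat m d"
    and inj: "\<And>v. v \<in> carrier_vec d \<Longrightarrow> Z *\<^sub>v v = 0\<^sub>v m \<Longrightarrow> v = 0\<^sub>v d"
    and ZR: "\<And>i. i \<in> {1..<n} \<Longrightarrow> (adj Z * Z) * R [i] = adj (R [i]) * (adj Z * Z)"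
    by (rule unitarizing_matrix) (rule that, assumption+)
  let ?P = "adj Z * Z"
  have P: "?P \<in> carrier_mat d d" by (rule mult_carrier_mat[OF adj_carrier[OF Z] Z])
  obtain Q where Q: "Q \<in> carrier_mat d d" "?P * Q = 1\<^sub>m d" "Q * ?P = 1\<^sub>m d" "adj Q = Q"
    by (rule gram_mat_inverse[OF Z inj])
  have PR: "?P * R (rev u) = adj (R u) * ?P" if "u \<in> lists {1..<n}" for u
    using that
  proof induction
    case Nil
    show ?case unfolding rev.simps R_Nil adj_one right_mult_one_mat[OF P] left_mult_one_mat[OF P] ..
  next
    case (Cons i u)
    have l: "[i] \<in> lists {1..<n}" "rev u \<in> lists {1..<n}" using Cons.hyps by (simp_all add: lists_eq_set)
    note Rs = R_carrier[OF l(1)] R_carrier[OF l(2)] R_carrier[OF Cons.hyps(2)]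
    have "?P * R (rev (i # u)) = ?P * R (rev u) * R [i]"
      unfolding rev.simps R_append[OF l(2,1)] by (rule assoc_mult_mat[OF P Rs(2,1), symmetric])
    also have "\<dots> = adj (R u) * (?P * R [i])"
      unfolding Cons.IH by (rule assoc_mult_mat[OF adj_carrier[OF Rs(3)] P Rs(1)])
    also have "\<dots> = adj (R u) * adj (R [i]) * ?P"
      unfolding ZR[OF Cons.hyps(1)]
      by (rule assoc_mult_mat[OF adj_carrier[OF Rs(3)] adj_carrier[OF Rs(1)] P, symmetric])
    also have "adj (R u) * adj (R [i]) = adj (R (i # u))"
      unfolding R_Cons[OF Cons.hyps] by (rule adj_mult[OF Rs(1,3), symmetric])
    finally show ?case .
  qed
  \<comment> \<open>W is to Q = P^(-1) what Z is to P, since Q P Q = Q. Then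
    \<open>Z * R u * adj W\<close> stands in for P^(1/2) (R u) P^(-1/2), without a matrix square
    root.\<close>
  define W where "W = Z * Q"
  have W: "W \<in> carrier_mat m d" using Z Q by (simp add: W_def)
  have WW: "adj W * W = Q"
  proof -
    have "adj W * W = Q * adj Z * (Z * Q)" unfolding W_def adj_mult[OF Z Q(1)] Q(4) ..
    also have "\<dots> = Q * (adj Z * (Z * Q))"
      by (rule assoc_mult_mat[OF Q(1) adj_carrier[OF Z] mult_carrier_mat[OF Z Q(1)]])
    also have "adj Z * (Z * Q) = ?P * Q"
      by (rule assoc_mult_mat[OF adj_carrier[OF Z] Z Q(1), symmetric])
    finally show ?thesis unfolding Q(2) right_mult_one_mat[OF Q(1)] .
  qed
  define \<zeta> where "\<zeta> u = Z * R u * adj W" for u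
  have \<zeta>: "\<zeta> u \<in> carrier_mat m m" if "u \<in> lists {1..<n}" for u
    using Z W R_carrier[OF that] unfolding \<zeta>_def by (intro mult_carrier_mat) auto
  have "mat_trace (R (rev u @ v)) = (\<Sum>x\<in>{..<m} \<times> {..<m}. cnj (\<zeta> u $$ x) * \<zeta> v $$ x)"
    if uv: "u \<in> lists {1..<n}" "v \<in> lists {1..<n}" for u v
  proof -
    have ul: "rev u \<in> lists {1..<n}" using uv(1) by (simp add: lists_eq_set)
    note Ru = R_carrier[OF uv(1)] and Rv = R_carrier[OF uv(2)] and Rr = R_carrier[OF ul]
    note aZ = adj_carrier[OF Z] and aW = adj_carrier[OF W] and aR = adj_carrier[OF Ru]
    let ?A = "adj (R u) * adj Z" and ?B = "Z * R v * adj W"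
    note ZRv = mult_carrier_mat[OF Z Rv] and A = mult_carrier_mat[OF aR aZ]
    note B = mult_carrier_mat[OF ZRv aW]
    have "adj (\<zeta> u) = W * ?A"
      unfolding \<zeta>_def adj_mult[OF mult_carrier_mat[OF Z Ru] aW] adj_mult[OF Z Ru] by simp
    then have "mat_trace (adj (\<zeta> u) * \<zeta> v) = mat_trace (W * (?A * ?B))"
      unfolding \<zeta>_def by (simp only: assoc_mult_mat[OF W A B])
    also have "\<dots> = mat_trace (?A * ?B * W)"
      by (rule mat_trace_comm[OF W mult_carrier_mat[OF A B]])
    also have "?A * ?B * W = ?A * (?B * W)" by (rule assoc_mult_mat[OF A B W])
    also have "?B * W = Z * R v * Q" by (simp only: assoc_mult_mat[OF ZRv aW W] WW)
    also have "?A * (Z * R v * Q) = ?A * (Z * R v) * Q"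
      by (rule assoc_mult_mat[OF A ZRv Q(1), symmetric])
    also have "?A * (Z * R v) = ?A * Z * R v" by (rule assoc_mult_mat[OF A Z Rv, symmetric])
    also have "?A * Z = adj (R u) * ?P" by (rule assoc_mult_mat[OF aR aZ Z])
    also have "\<dots> = ?P * R (rev u)" by (simp only: PR[OF uv(1)])
    also have "?P * R (rev u) * R v = ?P * (R (rev u) * R v)" by (rule assoc_mult_mat[OF P Rr Rv])
    also have "mat_trace (?P * (R (rev u) * R v) * Q) = mat_trace (Q * (?P * (R (rev u) * R v)))"
      by (rule mat_trace_comm[OF mult_carrier_mat[OF P mult_carrier_mat[OF Rr Rv]] Q(1)])
    also have "Q * (?P * (R (rev u) * R v)) = Q * ?P * (R (rev u) * R v)"
      by (rule assoc_mult_mat[OF Q(1) P mult_carrier_mat[OF Rr Rv], symmetric])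
    also have "\<dots> = R (rev u @ v)"
      unfolding Q(3) R_append[OF ul uv(2)] by (rule left_mult_one_mat[OF mult_carrier_mat[OF Rr Rv]])
    finally show ?thesis
      using mat_trace_adj_mult[OF \<zeta>[OF uv(1)] \<zeta>[OF uv(2)]] by (simp add: case_prod_unfold)
  qed
  with finite_cartesian_product[OF finite_lessThan finite_lessThan] show ?thesis by (rule that)
qed

end

section \<open>The second moment of the characters\<close>

lemma cmod_sum_mult_le:
  assumes "finite J"
  shows "(cmod (\<Sum>x\<in>J. f x * g x))\<^sup>2 \<le> (\<Sum>x\<in>J. (cmod (f x))\<^sup>2) * (\<Sum>x\<in>J. (cmod (g x))\<^sup>2)"
proof -
  have "cmod (\<Sum>x\<in>J. f x * g x) \<le> (\<Sum>x\<in>J. cmod (f x) * cmod (g x))"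
    by (rule order_trans[OF norm_sum]) (simp add: norm_mult)
  then have "(cmod (\<Sum>x\<in>J. f x * g x))\<^sup>2 \<le> (\<Sum>x\<in>J. cmod (f x) * cmod (g x))\<^sup>2"
    by (rule power_mono) simp
  also have "\<dots> \<le> (\<Sum>x\<in>J. (cmod (f x))\<^sup>2) * (\<Sum>x\<in>J. (cmod (g x))\<^sup>2)"
    by (rule Cauchy_Schwarz_ineq_sum)
  finally show ?thesis .
qed

text \<open>Cauchy-Schwarz in the Gram kernel against \<zeta> [], the vector of the identity, whose
  squared norm is the trace d. It cancels one of the two factors d that normalize the left-hand
  side, and the other one normalizes the characters on the right.\<close>

lemma (in hecke_representation) character_sum_bound:
  assumes d: "d > 0" and w: "\<And>j. j \<in> B \<Longrightarrow> w j \<in> lists {1..<n}"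
  defines "\<psi> \<equiv> \<lambda>w. normalized_character d \<rho> (hecke_word n q w)"
  shows "(cmod (\<Sum>j\<in>B. \<psi> (w j)))\<^sup>2 \<le> (\<Sum>j\<in>B. \<Sum>k\<in>B. Re (\<psi> (rev (w j) @ w k)))"
proof -
  obtain J :: "(nat \<times> nat) set" and \<zeta> where J: "finite J" and
    \<zeta>: "\<And>u v. u \<in> lists {1..<n} \<Longrightarrow> v \<in> lists {1..<n} \<Longrightarrow>
       mat_trace (R (rev u @ v)) = (\<Sum>x\<in>J. cnj (\<zeta> u x) * \<zeta> v x)"
    by (rule trace_gram) (rule that, assumption+)
  define S where "S x = (\<Sum>j\<in>B. \<zeta> (w j) x)" for x
  have rev: "rev u @ v \<in> lists {1..<n}" if "u \<in> lists {1..<n}" "v \<in> lists {1..<n}" for u v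
    using that unfolding lists_eq_set by simp
  have sq: "(\<Sum>x\<in>J. cnj (f x) * f x) = of_real (\<Sum>x\<in>J. (cmod (f x))\<^sup>2)" for f
    unfolding of_real_sum complex_norm_square by (simp only: mult.commute)
  have "of_nat d = mat_trace (R (rev [] @ []))" by (simp add: R_Nil mat_trace_def)
  also have "\<dots> = of_real (\<Sum>x\<in>J. (cmod (\<zeta> [] x))\<^sup>2)" using \<zeta>[OF lists.Nil lists.Nil] sq by simp
  finally have "complex_of_real (real d) = of_real (\<Sum>x\<in>J. (cmod (\<zeta> [] x))\<^sup>2)" by simp
  then have dim: "(\<Sum>x\<in>J. (cmod (\<zeta> [] x))\<^sup>2) = real d" by (simp only: of_real_eq_iff)
  have "(\<Sum>j\<in>B. mat_trace (R (w j))) = (\<Sum>j\<in>B. \<Sum>x\<in>J. cnj (\<zeta> [] x) * \<zeta> (w j) x)"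
    using \<zeta>[OF lists.Nil w] by (intro sum.cong) simp_all
  also have "\<dots> = (\<Sum>x\<in>J. cnj (\<zeta> [] x) * S x)"
    by (subst sum.swap) (simp add: S_def sum_distrib_left)
  finally have "(cmod (\<Sum>j\<in>B. mat_trace (R (w j))))\<^sup>2 \<le> real d * (\<Sum>x\<in>J. (cmod (S x))\<^sup>2)"
    using cmod_sum_mult_le[OF J, of "\<lambda>x. cnj (\<zeta> [] x)" S] dim by simp
  also have "complex_of_real (\<Sum>x\<in>J. (cmod (S x))\<^sup>2) = (\<Sum>j\<in>B. \<Sum>k\<in>B. mat_trace (R (rev (w j) @ w k)))"
  proof -
    have "complex_of_real (\<Sum>x\<in>J. (cmod (S x))\<^sup>2) = (\<Sum>x\<in>J. \<Sum>j\<in>B. \<Sum>k\<in>B. cnj (\<zeta> (w j) x) * \<zeta> (w k) x)"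
      unfolding sq[symmetric] by (simp add: S_def sum_product)
    also have "\<dots> = (\<Sum>j\<in>B. \<Sum>k\<in>B. \<Sum>x\<in>J. cnj (\<zeta> (w j) x) * \<zeta> (w k) x)"
      by (subst sum.swap, intro sum.cong refl sum.swap)
    also have "\<dots> = (\<Sum>j\<in>B. \<Sum>k\<in>B. mat_trace (R (rev (w j) @ w k)))"
      using \<zeta> w by (intro sum.cong) simp_all
    finally show ?thesis .
  qed
  then have "(\<Sum>x\<in>J. (cmod (S x))\<^sup>2) = Re (\<Sum>j\<in>B. \<Sum>k\<in>B. mat_trace (R (rev (w j) @ w k)))"
    by (metis Re_complex_of_real)
  finally have main: "(cmod (\<Sum>j\<in>B. mat_trace (R (w j))))\<^sup>2 \<le>
      real d * Re (\<Sum>j\<in>B. \<Sum>k\<in>B. mat_trace (R (rev (w j) @ w k)))" .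
  have \<psi>: "\<psi> u = mat_trace (R u) / of_nat d" if "u \<in> lists {1..<n}" for u
    unfolding \<psi>_def by (rule character_eq_trace[OF that])
  have "(\<Sum>j\<in>B. \<psi> (w j)) = (\<Sum>j\<in>B. mat_trace (R (w j))) / of_nat d"
    unfolding sum_divide_distrib using \<psi>[OF w] by (intro sum.cong) simp_all
  then have "(cmod (\<Sum>j\<in>B. \<psi> (w j)))\<^sup>2 = (cmod (\<Sum>j\<in>B. mat_trace (R (w j))))\<^sup>2 / (real d)\<^sup>2"
    by (simp add: norm_divide power_divide)
  also have "\<dots> \<le> Re (\<Sum>j\<in>B. \<Sum>k\<in>B. mat_trace (R (rev (w j) @ w k))) / real d"
    using main d by (simp add: divide_simps power2_eq_square mult.commute)
  also have "\<dots> = Re ((\<Sum>j\<in>B. \<Sum>k\<in>B. mat_trace (R (rev (w j) @ w k))) / of_nat d)"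
    by (simp add: Re_divide_of_nat)
  also have "(\<Sum>j\<in>B. \<Sum>k\<in>B. mat_trace (R (rev (w j) @ w k))) / of_nat d = (\<Sum>j\<in>B. \<Sum>k\<in>B. \<psi> (rev (w j) @ w k))"
    unfolding sum_divide_distrib using \<psi>[OF rev[OF w w]] by (intro sum.cong) simp_all
  finally show ?thesis by simp
qed

lemma (in hecke_representation) character_shift:
  assumes "\<forall>i \<in> set w. 1 \<le> i \<and> i + m < n"
  shows "normalized_character d \<rho> (hecke_word n q (map (\<lambda>i. i + m) w)) =
         normalized_character d \<rho> (hecke_word n q w)"
proof -
  have "map (\<lambda>i. i + m) w \<in> lists {1..<n}" "w \<in> lists {1..<n}"
    using assms by force+
  then show ?thesis by (simp only: character_eq_trace trace_shift[OF assms])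
qed

lemma finite_int_partitions: "finite (int_partitions n)"
proof (rule finite_subset)
  have len: "length xs \<le> sum_list xs" if "0 \<notin> set xs" for xs :: "nat list"
    using that by (induction xs) auto
  show "int_partitions n \<subseteq> {xs. set xs \<subseteq> {..n} \<and> length xs \<le> n}"
    using len by (auto simp: int_partitions_def int_partition_def dest: member_le_sum_list)
  show "finite {xs. set xs \<subseteq> {..n} \<and> length xs \<le> n}"
    by (rule finite_lists_length_le) simp
qed

text \<open>The translated first letter occurs once: w has no repeated letter, and all letters lie
  strictly between 0 and l, so division by l tells the two translates apart.\<close>

lemma unit_coeff_disjoint_shifts:
  assumes w: "distinct w" "w \<noteq> []" "w \<in> lists {1..<l}" and jk: "j \<noteq> k"
  shows "unit_coeff q (rev (map (\<lambda>i. i + j * l) w) @ map (\<lambda>i. i + k * l) w) = 0"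
proof -
  obtain x v where xv: "w = x # v" using w(2) by (cases w) auto
  have block: "(y + m * l) div l = m" if "y \<in> set w" for y m
    using that w(3) by auto
  have "x + j * l \<notin> set (rev (map (\<lambda>i. i + j * l) v))"
    using w(1) xv by auto
  moreover have "x + j * l \<notin> set (map (\<lambda>i. i + k * l) w)"
  proof
    assume "x + j * l \<in> set (map (\<lambda>i. i + k * l) w)"
    then obtain y where "y \<in> set w" "x + j * l = y + k * l" by auto
    with block[of x j] block[of y k] jk xv show False by simp
  qed
  ultimately have "unit_coeff q (rev (map (\<lambda>i. i + j * l) v) @ (x + j * l) # map (\<lambda>i. i + k * l) w) = 0"
    by (rule unit_coeff_single_letter)
  then show ?thesis by (simp add: xv)
qed

text \<open>Summing over the N translates multiplies the character by N, hence its squared modulus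
  by N^2. Of the N^2 products bounding that square, only the N diagonal ones have a nonzero mean, so
  one factor N remains on the left.\<close>

lemma character_second_moment:
  fixes q :: real and d :: "nat list \<Rightarrow> nat"
  assumes q: "q > 0"
    and V: "\<And>lam. lam \<in> int_partitions n \<Longrightarrow> hecke_irrep n q (d lam) (V lam)"
    and M: "is_q_plancherel n q d V M"
    and w: "distinct w" "w \<noteq> []" "w \<in> lists {1..<l}" and n: "l \<le> n"
  defines "\<psi> \<equiv> \<lambda>lam w. normalized_character (d lam) (V lam) (hecke_word n q w)"
  shows "real (n div l) * (\<Sum>lam\<in>int_partitions n. pmf M lam * (cmod (\<psi> lam w))\<^sup>2) \<le> Re (unit_coeff q (rev w @ w))"
proof -
  have l: "l > 0" using w by (cases w) auto
  define N where "N = n div l"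
  have "N > 0" using n l by (simp add: N_def div_greater_zero_iff)
  define s where "s j = map (\<lambda>i. i + j * l) w" for j
  have bound: "i + j * l < n" if "i < l" "j < N" for i j
  proof -
    have "i + j * l < Suc j * l" using that by simp
    also have "\<dots> \<le> N * l" using that by (intro mult_right_mono) auto
    also have "\<dots> \<le> n" by (simp add: N_def)
    finally show ?thesis .
  qed
  have wl: "1 \<le> i" "i < l" if "i \<in> set w" for i using that w(3) by auto
  have shift: "\<forall>i \<in> set w. 1 \<le> i \<and> i + j * l < n" if "j < N" for j using wl bound that by auto
  have s: "s j \<in> lists {1..<n}" if "j < N" for j
    using shift[OF that] unfolding s_def lists_eq_set by auto
  have rep: "hecke_representation n q (d lam) (V lam)" "d lam > 0" if "lam \<in> int_partitions n" for lam
    using V[OF that] q by (simp_all add: hecke_representation_def hecke_irrep_def)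
  have \<psi>_s: "\<psi> lam (s j) = \<psi> lam w" if "lam \<in> int_partitions n" "j < N" for lam j
    unfolding \<psi>_def s_def by (rule hecke_representation.character_shift[OF rep(1)[OF that(1)] shift[OF that(2)]])
  have trace: "unit_coeff q u = (\<Sum>lam\<in>int_partitions n. of_real (pmf M lam) * \<psi> lam u)" if "u \<in> lists {1..<n}" for u
    using M hecke_word_closed[OF that] unfolding is_q_plancherel_def canonical_trace_hecke_word[OF that, symmetric] \<psi>_def
    by blast
  have rev: "rev u @ v \<in> lists {1..<n}" if "u \<in> lists {1..<n}" "v \<in> lists {1..<n}" for u v
    using that unfolding lists_eq_set by simp
  have coeff: "unit_coeff q (rev (s j) @ s k) = (if j = k then unit_coeff q (rev w @ w) else 0)"
    if "j < N" "k < N" for j k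
  proof (cases "j = k")
    \<comment> \<open>The diagonal value is the same for all j because \<open>unit_coeff\<close> is
      a mean of characters, each of them invariant under the shift.\<close>
    case True
    have wn: "w \<in> lists {1..<n}" using w(3) n unfolding lists_eq_set by auto
    have "\<psi> lam (rev (s j) @ s j) = \<psi> lam (rev w @ w)" if "lam \<in> int_partitions n" for lam
      using hecke_representation.character_shift[OF rep(1)[OF that], of "rev w @ w" "j * l"] shift[OF \<open>j < N\<close>]
      by (simp add: \<psi>_def s_def rev_map ball_Un)
    then show ?thesis using True by (simp add: trace[OF rev[OF s s]] trace[OF rev[OF wn wn]] that)
  next
    case False
    then show ?thesis using unit_coeff_disjoint_shifts[OF w] by (simp add: s_def)
  qed
  have "(real N)\<^sup>2 * (\<Sum>lam\<in>int_partitions n. pmf M lam * (cmod (\<psi> lam w))\<^sup>2) =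
      (\<Sum>lam\<in>int_partitions n. pmf M lam * (cmod (\<Sum>j<N. \<psi> lam (s j)))\<^sup>2)"
    unfolding sum_distrib_left
    by (intro sum.cong) (simp_all add: \<psi>_s norm_mult power_mult_distrib)
  also have "\<dots> \<le> (\<Sum>lam\<in>int_partitions n. pmf M lam * (\<Sum>j<N. \<Sum>k<N. Re (\<psi> lam (rev (s j) @ s k))))"
    unfolding \<psi>_def using s rep
    by (intro sum_mono mult_left_mono hecke_representation.character_sum_bound) auto
  also have "\<dots> = (\<Sum>lam\<in>int_partitions n. \<Sum>j<N. \<Sum>k<N. Re (of_real (pmf M lam) * \<psi> lam (rev (s j) @ s k)))"
    by (simp add: sum_distrib_left)
  also have "\<dots> = (\<Sum>j<N. \<Sum>k<N. \<Sum>lam\<in>int_partitions n. Re (of_real (pmf M lam) * \<psi> lam (rev (s j) @ s k)))"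
    by (subst sum.swap, intro sum.cong refl sum.swap)
  also have "\<dots> = (\<Sum>j<N. \<Sum>k<N. Re (unit_coeff q (rev (s j) @ s k)))"
    using s by (intro sum.cong) (simp_all add: trace[OF rev])
  also have "\<dots> = (\<Sum>j<N. \<Sum>k<N. if j = k then Re (unit_coeff q (rev w @ w)) else 0)"
    using coeff by (intro sum.cong) auto
  also have "\<dots> = real N * Re (unit_coeff q (rev w @ w))"
    by simp
  finally show ?thesis
    using \<open>N > 0\<close> unfolding N_def[symmetric] by (simp add: power2_eq_square mult.assoc)
qed

section \<open>From the second moment to convergence in probability\<close>

text \<open>Chebyshev's inequality. The distance is prescribed only on a finite set carrying the
  measure, since the characters are controlled for the partitions of n.\<close>

lemma prob_le_second_moment:
  assumes "set_pmf M \<subseteq> S" "finite S" "\<epsilon> > 0" and X: "\<And>x. x \<in> S \<Longrightarrow> dist (X x) c = f x"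
  shows "measure_pmf.prob M {x. dist (X x) c > \<epsilon>} \<le> (\<Sum>x\<in>S. pmf M x * (f x)\<^sup>2) / \<epsilon>\<^sup>2"
proof -
  have "measure_pmf.prob M {x. dist (X x) c > \<epsilon>} = measure_pmf.prob M ({x. dist (X x) c > \<epsilon>} \<inter> set_pmf M)"
    by (simp add: measure_Int_set_pmf)
  also have "\<dots> \<le> measure_pmf.prob M {x \<in> S. f x > \<epsilon>}"
    using assms(1) X by (intro measure_pmf.finite_measure_mono) (auto simp: subset_iff)
  also have "\<dots> = (\<Sum>x | x \<in> S \<and> f x > \<epsilon>. pmf M x)"
    using assms(2) by (simp add: measure_measure_pmf_finite)
  also have "\<dots> \<le> (\<Sum>x | x \<in> S \<and> f x > \<epsilon>. pmf M x * (f x)\<^sup>2 / \<epsilon>\<^sup>2)"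
  proof (rule sum_mono)
    fix x assume "x \<in> {x. x \<in> S \<and> f x > \<epsilon>}"
    then have "\<epsilon>\<^sup>2 \<le> (f x)\<^sup>2" using assms(3) by (intro power_mono) auto
    then have "pmf M x * 1 \<le> pmf M x * ((f x)\<^sup>2 / \<epsilon>\<^sup>2)"
      using assms(3) by (intro mult_left_mono) (auto simp: divide_simps)
    then show "pmf M x \<le> pmf M x * (f x)\<^sup>2 / \<epsilon>\<^sup>2" by simp
  qed
  also have "\<dots> \<le> (\<Sum>x\<in>S. pmf M x * (f x)\<^sup>2 / \<epsilon>\<^sup>2)"
    using assms(2) by (intro sum_mono2) auto
  finally show ?thesis by (simp add: sum_divide_distrib)
qed

text \<open>X and c stay abstract so that one statement serves both \<open>hecke_T\<close>, with the
  trace as its limit, and an explicit word, with limit 0. The distance is prescribed from n = l on,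
  where all letters of w are generators.\<close>

lemma character_converges:
  fixes q :: real and d :: "nat \<Rightarrow> nat list \<Rightarrow> nat" and c :: "nat \<Rightarrow> complex"
  assumes q: "q > 0"
    and V: "\<And>n lam. lam \<in> int_partitions n \<Longrightarrow> hecke_irrep n q (d n lam) (V n lam)"
    and M: "\<And>n. is_q_plancherel n q (d n) (V n) (M n)"
    and w: "distinct w" "w \<noteq> []" "w \<in> lists {1..<l}"
    and X: "\<And>n lam. l \<le> n \<Longrightarrow> lam \<in> int_partitions n \<Longrightarrow>
        dist (X n lam) (c n) = cmod (normalized_character (d n lam) (V n lam) (hecke_word n q w))"
  shows "converges_in_probability M X c"
  unfolding converges_in_probability_def
proof (intro allI impI)
  fix \<epsilon> :: real assume \<epsilon>: "\<epsilon> > 0"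
  have l: "l > 0" using w by (cases w) auto
  let ?C = "Re (unit_coeff q (rev w @ w)) / \<epsilon>\<^sup>2"
  have bound: "measure_pmf.prob (M n) {lam. dist (X n lam) (c n) > \<epsilon>} \<le> ?C / real (n div l)" if n: "l \<le> n" for n
  proof -
    let ?m = "\<Sum>lam\<in>int_partitions n. pmf (M n) lam *
        (cmod (normalized_character (d n lam) (V n lam) (hecke_word n q w)))\<^sup>2"
    have pos: "real (n div l) > 0" using n l by (simp add: div_greater_zero_iff)
    have "measure_pmf.prob (M n) {lam. dist (X n lam) (c n) > \<epsilon>} \<le> ?m / \<epsilon>\<^sup>2"
      by (rule prob_le_second_moment[OF conjunct1[OF M[unfolded is_q_plancherel_def]] finite_int_partitions \<epsilon> X[OF n]])
    also have "?m / \<epsilon>\<^sup>2 \<le> Re (unit_coeff q (rev w @ w)) / real (n div l) / \<epsilon>\<^sup>2"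
    proof (rule divide_right_mono)
      show "?m \<le> Re (unit_coeff q (rev w @ w)) / real (n div l)"
        unfolding pos_le_divide_eq[OF pos]
        using character_second_moment[OF q V M w n] by (simp only: mult.commute)
    qed simp
    finally show ?thesis by (simp only: divide_divide_eq_left mult.commute)
  qed
  have "filterlim (\<lambda>n. n div l) at_top sequentially"
    unfolding filterlim_at_top
  proof
    fix Z
    have "\<forall>n\<ge>Z * l. Z \<le> n div l" using l by (simp add: less_eq_div_iff_mult_less_eq)
    then show "\<forall>\<^sub>F n in sequentially. Z \<le> n div l"
      unfolding eventually_sequentially by blast
  qed
  then have "filterlim (\<lambda>n. real (n div l)) at_top sequentially"
    by (rule filterlim_compose[OF filterlim_real_sequentially])
  then have "(\<lambda>n. ?C / real (n div l)) \<longlonglongrightarrow> 0"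
    by (intro tendsto_divide_0[OF tendsto_const] filterlim_at_top_imp_at_infinity)
  moreover have "\<forall>\<^sub>F n in sequentially. measure_pmf.prob (M n) {lam. dist (X n lam) (c n) > \<epsilon>} \<le> ?C / real (n div l)"
    using bound by (rule eventually_sequentiallyI)
  ultimately show "(\<lambda>n. measure_pmf.prob (M n) {lam. dist (X n lam) (c n) > \<epsilon>}) \<longlonglongrightarrow> 0"
    by (intro tendsto_sandwich[OF always_eventually[OF allI[OF measure_nonneg]] _ tendsto_const])
qed

section \<open>Words for products of consecutive cycles\<close>

lemma word_perm_upt: "word_perm [a..<b] = cycle_of_list [a..<Suc b]"
proof (induction "b - a" arbitrary: a)
  case 0
  then show ?case by (cases "a = b") auto
next
  case (Suc m)
  then have "a < b" by simp
  then have "[a..<b] = a # [Suc a..<b]" "[a..<Suc b] = a # Suc a # [Suc (Suc a)..<Suc b]"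
    "[Suc a..<Suc b] = Suc a # [Suc (Suc a)..<Suc b]"
    by (simp_all add: upt_conv_Cons del: upt_Suc)
  moreover have "word_perm [Suc a..<b] = cycle_of_list [Suc a..<Suc b]" using Suc by simp
  ultimately show ?case by (simp del: upt_Suc)
qed

text \<open>A positive part m contributes m - 1 letters, and the letter joining two neighbouring
  cycles is left out. The word is increasing, so it is repetition-free and
  \<open>distinct_reduced_word\<close> applies.\<close>

fun cycles_word :: "nat \<Rightarrow> nat list \<Rightarrow> nat list" where
  "cycles_word a [] = []"
| "cycles_word a (m # ms) = [Suc a..<a + m] @ cycles_word (a + m) ms"

lemma word_perm_cycles_word: "word_perm (cycles_word a mu) = consecutive_cycles a mu"
  by (induction mu arbitrary: a) (simp_all add: word_perm_upt del: upt_Suc id_apply)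

lemma set_cycles_word: "set (cycles_word a mu) \<subseteq> {a<..<a + sum_list mu}"
proof (induction mu arbitrary: a)
  case (Cons m mu)
  show ?case using Cons[of "a + m"] by (fastforce simp: subset_iff)
qed simp

lemma distinct_cycles_word: "distinct (cycles_word a mu)"
proof (induction mu arbitrary: a)
  case (Cons m mu)
  show ?case using Cons[of "a + m"] set_cycles_word[of "a + m" mu] by (fastforce simp: subset_iff)
qed simp

theorem proposition2:
  fixes q :: real and mu :: "nat list"
    and d :: "nat \<Rightarrow> nat list \<Rightarrow> nat"
    and V :: "nat \<Rightarrow> nat list \<Rightarrow> (nat list \<Rightarrow> complex) set \<Rightarrow> complex mat"
    and M :: "nat \<Rightarrow> nat list pmf"
  assumes "q > 0" and "q \<noteq> 1"
    and "int_partition mu"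
    and "\<And>n lam. lam \<in> int_partitions n \<Longrightarrow> hecke_irrep_of_type n q lam (d n lam) (V n lam)"
    and "\<And>n. is_q_plancherel n q (d n) (V n) (M n)"
  shows "converges_in_probability M
           (\<lambda>n lam. normalized_character (d n lam) (V n lam) (hecke_T n q (partition_perm mu)))
           (\<lambda>n. canonical_trace n q (hecke_T n q (partition_perm mu))) \<and>
         (\<forall>k\<ge>2. converges_in_probability M
           (\<lambda>n lam. normalized_character (d n lam) (V n lam) (hecke_word n q [1..<k]))
           (\<lambda>n. 0))"
proof -
  have V: "hecke_irrep n q (d n lam) (V n lam)" if "lam \<in> int_partitions n" for n lam
    using assms(4)[OF that] by (simp add: hecke_irrep_of_type_def)
  have reps: "hecke_representation n q (d n lam) (V n lam)" "d n lam > 0" if "lam \<in> int_partitions n" for n lam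
    using V[OF that] \<open>q > 0\<close> by (simp_all add: hecke_representation_def hecke_irrep_def)
  let ?w = "cycles_word 0 mu" and ?l = "sum_list mu"
  have perm: "word_perm ?w = partition_perm mu"
    by (simp only: partition_perm_def word_perm_cycles_word)
  have wl: "?w \<in> lists {1..<n}" if "?l \<le> n" for n
    using set_cycles_word[of 0 mu] that unfolding lists_eq_set by fastforce
  have red: "reduced_word n (partition_perm mu) ?w" if "?l \<le> n" for n
    using distinct_reduced_word[OF distinct_cycles_word wl[OF that]] by (simp only: perm)
  have perm_n: "partition_perm mu permutes {1..n}" if "?l \<le> n" for n
    using word_perm_permutes[OF wl[OF that]] by (simp only: perm)
  have char: "normalized_character (d n lam) (V n lam) (hecke_T n q (partition_perm mu)) =
      normalized_character (d n lam) (V n lam) (hecke_word n q ?w)"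
    if "?l \<le> n" "lam \<in> int_partitions n" for n lam
    using hecke_linear_form_T[OF hecke_representation.linear_form_character[OF reps(1)[OF that(2)]] red[OF that(1)]] .
  have trace: "canonical_trace n q (hecke_T n q (partition_perm mu)) = unit_coeff q ?w" if "?l \<le> n" for n
    unfolding canonical_trace_hecke_T[OF perm_n[OF that]] unit_coeff_reduced[OF red[OF that]] ..
  have "converges_in_probability M
      (\<lambda>n lam. normalized_character (d n lam) (V n lam) (hecke_T n q (partition_perm mu)))
      (\<lambda>n. canonical_trace n q (hecke_T n q (partition_perm mu)))"
  proof (cases "?w = []")
    case False
    then obtain i v where iv: "?w = i # v" by (cases ?w) auto
    \<comment> \<open>The first letter occurs only once. The trace being 0, the distance to it is
      the modulus of the character.\<close>
    have "unit_coeff q ?w = 0"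
      using unit_coeff_single_letter[of i "[]" v q] distinct_cycles_word[of 0 mu] by (simp add: iv)
    then show ?thesis
      by (intro character_converges[OF \<open>q > 0\<close> V assms(5) distinct_cycles_word False wl[OF order_refl]])
        (simp_all only: char trace dist_norm diff_zero)
  next
    \<comment> \<open>All parts are 1 here: the permutation is the identity, and character and trace
      both equal 1 once n reaches the sum of the parts, so the probabilities are eventually
      0.\<close>
    case True
    have one: "normalized_character (d n lam) (V n lam) (hecke_word n q []) = 1" if "lam \<in> int_partitions n" for n lam
    proof -
      interpret hecke_representation n q "d n lam" "V n lam" by (rule reps(1)[OF that])
      show ?thesis using reps(2)[OF that] by (simp add: character_eq_trace R_Nil mat_trace_def)
    qed
    have unit: "unit_coeff q [] = 1" by (simp add: unit_coeff_reduced[OF reduced_word_Nil] del: id_apply)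
    have zero: "measure_pmf.prob (M n) {lam. dist (normalized_character (d n lam) (V n lam) (hecke_T n q (partition_perm mu)))
        (canonical_trace n q (hecke_T n q (partition_perm mu))) > \<epsilon>} = 0" if "?l \<le> n" "\<epsilon> > 0" for n \<epsilon>
    proof -
      have "set_pmf (M n) \<subseteq> int_partitions n" using assms(5)[of n] by (simp add: is_q_plancherel_def)
      then have "set_pmf (M n) \<inter> {lam. dist (normalized_character (d n lam) (V n lam) (hecke_T n q (partition_perm mu)))
        (canonical_trace n q (hecke_T n q (partition_perm mu))) > \<epsilon>} = {}"
        using that(2) by (auto simp: char[OF that(1)] trace[OF that(1)] True one unit)
      then show ?thesis by (simp add: measure_pmf_zero_iff)
    qed
    show ?thesis
      unfolding converges_in_probability_def
    proof (intro allI impI)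
      fix \<epsilon> :: real assume "\<epsilon> > 0"
      from eventually_sequentiallyI[OF zero[OF _ this]] show "(\<lambda>n. measure_pmf.prob (M n) {lam. dist
          (normalized_character (d n lam) (V n lam) (hecke_T n q (partition_perm mu)))
          (canonical_trace n q (hecke_T n q (partition_perm mu))) > \<epsilon>}) \<longlonglongrightarrow> 0"
        by (rule tendsto_eventually)
    qed
  qed
  moreover have "converges_in_probability M
      (\<lambda>n lam. normalized_character (d n lam) (V n lam) (hecke_word n q [1..<k])) (\<lambda>n. 0)"
    if "2 \<le> k" for k
  proof -
    \<comment> \<open>The bound l on the letters is k itself, and k at least 2 makes the word
      nonempty.\<close>
    have k: "[1..<k] \<noteq> []" "[1..<k] \<in> lists {1..<k}"
      using that unfolding lists_eq_set by simp_all
    show ?thesis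
    proof (rule character_converges[OF \<open>q > 0\<close> V assms(5) distinct_upt k])
      show "dist (normalized_character (d n lam) (V n lam) (hecke_word n q [1..<k])) 0 =
          cmod (normalized_character (d n lam) (V n lam) (hecke_word n q [1..<k]))" for n lam
        by (simp add: dist_norm)
    qed
  qed
  ultimately show ?thesis by blast
qed

end
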